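(* The problem Constraint Readiness (given an instance $I$, a set $\Pi$ of procedures, and a property $\alpha$ of instances specified as a tgd or an egd, is there a sequence $P_1,\dots,P_n$ of procedures in $\Pi$ such that all the instances in $\mathrm{outcomes}_{P_1,\dots,P_n}(I)$ satisfy $\alpha$?) is undecidable, even if $\Pi$ is a set of procedures with safe scope and $\alpha$ is a single acyclic tgd.
   Context: Fix disjoint countably infinite sets of attribute names (totally ordered), domain values $D$, and relation names. A schema $S$ is a partial function with finite domain from relation names to finite sets of attributes; "$R$ is in $S$" means $S(R)$ is defined. An instance $I$ of $S$ assigns to each $R$ in $S$ a finite set $R^I$ of tuples, i.e. functions $S(R)\to D$ (also written as value lists in attribute order). A named atom $R(A_1:x_1,\dots,A_k:x_k)$ (the $x_i$ are variables) is compatible with $S$ if $\{A_1,\dots,A_k\}\subseteq S(R)$; $(I,\tau)$ satisfies it if some $t\in R^I$ has $t(A_i)=\tau(x_i)$ for all $i$. A conjunctive query (CQ) is $\exists \bar z\,\phi(\bar z,\bar y)$ with $\phi$ a conjunction of named atoms; it is compatible with $S$ if all its atoms are. A total query is a relation name $R$; it is compatible with $S$ if $R$ is in $S$, and its result $Q(I)$ is the set of all (unnamed) tuples in $R^I$. A tgd is $\forall \bar x(\exists \bar y\,\phi(\bar x,\bar y)\to\exists\bar z\,\psi(\bar x,\bar z))$ and an egd is $\forall \bar x(\exists\bar y\,\phi(\bar x,\bar y)\to x=x')$ with $x,x'$ in $\bar x$, where $\phi,\psi$ are conjunctions of named atoms. $I\models\Sigma$ means that every CQ in $\Sigma$ is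 compatible with the schema of $I$ and every dependency in $\Sigma$ holds in $I$ in the usual first-order sense. A tgd is acyclic if none of the relations on its right-hand side appears on its left-hand side. A set of tgds is acyclic if the directed graph on relation names with an edge from $R$ to $R'$ whenever some tgd in the set has $R$ on the left-hand side and $R'$ on the right-hand side is acyclic. A structure constraint is $R[\bar s]$ ($\bar s$ a tuple of attributes) or $R[*]$. A procedure is $P=(\mathrm{Scope},C_{in},C_{out},Q_{pres})$: $\mathrm{Scope}$ is a set of structure constraints, $C_{in}$ and $C_{out}$ (pre- and postconditions) are sets of constraints, and $Q_{pres}$ is a set of queries. $P$ is applicable on $I$ over $S$ if each query in $Q_{pres}$ is compatible with $S$ and $I\models C_{in}$. An instance $I'$ over the same schema $S$ is a possible outcome of applying $P$ to $I$ if (1) $P$ is applicable on $I$; (2) $I'\models C_{out}$; (3) $I$ and $I'$ agree outside the scope: $R^I=R^{I'}$ for every $R$ in $S$ not mentioned in $\mathrm{Scope}$, and for every $T$ in $S$ mentioned in $\mathrm{Scope}$ with $T[*]\notin\mathrm{Scope}$, the projections of $T^I$ and $T^{I'}$ onto the attributes of $S(T)$ not mentioned in any $T[\bar s]\in\mathrm{Scope}$ coincide; (4) $Q(I)\subseteq Q(I')$ for each $Q\in Q_{pres}$. $\mathrm{outcomes}_P(I)$ is the set of all possible outcomes; for a set $\mathcal I$ of instances, $\mathrm{outcomes}_P(\mathcal I)=\bigcup_{I\in\mathcal I}\mathrm{outcomes}_P(I)$; and $\mathrm{outcomes}_{P_1,\dots,P_n}(I)=\mathrm{outcomes}_{P_n}(\cdots(\mathrm{outcomes}_{P_1}(I))\cdots)$.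 $P$ has safe scope if: $C_{in}=\emptyset$; $C_{out}$ is an acyclic set of tgds; $\mathrm{Scope}$ consists of exactly one constraint $R[*]$ for each relation $R$ appearing on the right-hand side of a tgd in $C_{out}$; and $Q_{pres}$ consists of one total query $R$ for each $R[*]\in\mathrm{Scope}$. In the readiness problem the length $n$ is not part of the input, and procedures of $\Pi$ may be repeated in the sequence. *)

theory Defs
  imports Main "HOL-Library.Nat_Bijection"
begin

section \<open>Relational instances\<close>

text \<open>
  Attribute names, domain values, relation names and variables are four separate copies of the
  natural numbers. No operation below compares members of different copies, so disjointness
  is never an issue. The order on attributes is the order on \<^typ>\<open>nat\<close>.
\<close>

type_synonym attr = nat
type_synonym dval = nat
type_synonym relname = nat
type_synonym var = nat

type_synonym schema = "relname \<rightharpoonup> attr set"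
type_synonym tuple = "attr \<rightharpoonup> dval"

definition wf_schema :: "schema \<Rightarrow> bool" where
  "wf_schema S \<longleftrightarrow> finite (dom S) \<and> (\<forall>R\<in>dom S. finite (the (S R)))"

datatype db = DB (sch: schema) (rel: "relname \<Rightarrow> tuple set")

text \<open>
  Relations that are not in the schema are interpreted by the empty set, so that two instances
  of the same schema are equal as soon as they agree on the relations of the schema.
\<close>

definition wf_db :: "db \<Rightarrow> bool" where
  "wf_db I \<longleftrightarrow> wf_schema (sch I)
     \<and> (\<forall>R\<in>dom (sch I). finite (rel I R) \<and> (\<forall>t\<in>rel I R. dom t = the (sch I R)))
     \<and> (\<forall>R. R \<notin> dom (sch I) \<longrightarrow> rel I R = {})"

definition unnamed :: "attr set \<Rightarrow> tuple \<Rightarrow> dval list" where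
  "unnamed As t = map (\<lambda>A. the (t A)) (sorted_list_of_set As)"


section \<open>Queries and dependencies\<close>

datatype atom = Atom (atom_rel: relname) (atom_args: "(attr \<times> var) list")

text \<open>\<open>CQ zs as\<close> is the conjunction of the atoms \<open>as\<close>, with the variables \<open>zs\<close> existentially quantified.\<close>

datatype cq = CQ (ex_vars: "var list") (cq_atoms: "atom list")

datatype query = Conj cq | Total relname

text \<open>
  \<open>TGD \<phi> \<psi>\<close> and \<open>EGD \<phi> x x'\<close> are universally quantified over the free variables of \<open>\<phi>\<close>.
\<close>

datatype dependency = TGD cq cq | EGD cq var var

definition cq_vars :: "cq \<Rightarrow> var set" where
  "cq_vars q = (\<Union>a\<in>set (cq_atoms q). snd ` set (atom_args a))"

definition free_vars :: "cq \<Rightarrow> var set" where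
  "free_vars q = cq_vars q - set (ex_vars q)"

definition cq_rels :: "cq \<Rightarrow> relname set" where
  "cq_rels q = atom_rel ` set (cq_atoms q)"

definition wf_atom :: "atom \<Rightarrow> bool" where
  "wf_atom a \<longleftrightarrow> atom_args a \<noteq> [] \<and> distinct (map fst (atom_args a))"

definition wf_cq :: "cq \<Rightarrow> bool" where
  "wf_cq q \<longleftrightarrow> cq_atoms q \<noteq> [] \<and> (\<forall>a\<in>set (cq_atoms q). wf_atom a)
     \<and> distinct (ex_vars q) \<and> set (ex_vars q) \<subseteq> cq_vars q"

fun wf_query :: "query \<Rightarrow> bool" where
  "wf_query (Conj q) \<longleftrightarrow> wf_cq q"
| "wf_query (Total R) \<longleftrightarrow> True"

fun wf_dependency :: "dependency \<Rightarrow> bool" where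
  "wf_dependency (TGD \<phi> \<psi>) \<longleftrightarrow> wf_cq \<phi> \<and> wf_cq \<psi> \<and> free_vars \<psi> \<subseteq> free_vars \<phi>"
| "wf_dependency (EGD \<phi> x x') \<longleftrightarrow> wf_cq \<phi> \<and> x \<in> free_vars \<phi> \<and> x' \<in> free_vars \<phi>"

definition atom_compatible :: "schema \<Rightarrow> atom \<Rightarrow> bool" where
  "atom_compatible S a \<longleftrightarrow>
     (\<exists>As. S (atom_rel a) = Some As \<and> fst ` set (atom_args a) \<subseteq> As)"

definition cq_compatible :: "schema \<Rightarrow> cq \<Rightarrow> bool" where
  "cq_compatible S q \<longleftrightarrow> (\<forall>a\<in>set (cq_atoms q). atom_compatible S a)"

fun query_compatible :: "schema \<Rightarrow> query \<Rightarrow> bool" where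
  "query_compatible S (Conj q) \<longleftrightarrow> cq_compatible S q"
| "query_compatible S (Total R) \<longleftrightarrow> R \<in> dom S"

fun dependency_compatible :: "schema \<Rightarrow> dependency \<Rightarrow> bool" where
  "dependency_compatible S (TGD \<phi> \<psi>) \<longleftrightarrow> cq_compatible S \<phi> \<and> cq_compatible S \<psi>"
| "dependency_compatible S (EGD \<phi> x x') \<longleftrightarrow> cq_compatible S \<phi>"

definition sat_atom :: "db \<Rightarrow> (var \<Rightarrow> dval) \<Rightarrow> atom \<Rightarrow> bool" where
  "sat_atom I \<tau> a \<longleftrightarrow>
     (\<exists>t\<in>rel I (atom_rel a). \<forall>(A, x)\<in>set (atom_args a). t A = Some (\<tau> x))"

definition sat_cq :: "db \<Rightarrow> (var \<Rightarrow> dval) \<Rightarrow> cq \<Rightarrow> bool" where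
  "sat_cq I \<tau> q \<longleftrightarrow>
     (\<exists>\<tau>'. (\<forall>x. x \<notin> set (ex_vars q) \<longrightarrow> \<tau>' x = \<tau> x) \<and> (\<forall>a\<in>set (cq_atoms q). sat_atom I \<tau>' a))"

fun holds :: "db \<Rightarrow> dependency \<Rightarrow> bool" where
  "holds I (TGD \<phi> \<psi>) \<longleftrightarrow> (\<forall>\<tau>. sat_cq I \<tau> \<phi> \<longrightarrow> sat_cq I \<tau> \<psi>)"
| "holds I (EGD \<phi> x x') \<longleftrightarrow> (\<forall>\<tau>. sat_cq I \<tau> \<phi> \<longrightarrow> \<tau> x = \<tau> x')"

definition models :: "db \<Rightarrow> dependency set \<Rightarrow> bool" where
  "models I \<Sigma> \<longleftrightarrow> (\<forall>d\<in>\<Sigma>. dependency_compatible (sch I) d \<and> holds I d)"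

fun query_result :: "query \<Rightarrow> db \<Rightarrow> dval list set" where
  "query_result (Conj q) I = {map \<tau> (sorted_list_of_set (free_vars q)) | \<tau>. sat_cq I \<tau> q}"
| "query_result (Total R) I = unnamed (the (sch I R)) ` rel I R"

fun acyclic_tgd :: "dependency \<Rightarrow> bool" where
  "acyclic_tgd (TGD \<phi> \<psi>) \<longleftrightarrow> cq_rels \<phi> \<inter> cq_rels \<psi> = {}"
| "acyclic_tgd (EGD \<phi> x x') \<longleftrightarrow> False"

definition acyclic_tgds :: "dependency set \<Rightarrow> bool" where
  "acyclic_tgds \<Sigma> \<longleftrightarrow> (\<forall>d\<in>\<Sigma>. \<exists>\<phi> \<psi>. d = TGD \<phi> \<psi>)
     \<and> acyclic {(R, R'). \<exists>\<phi> \<psi>. TGD \<phi> \<psi> \<in> \<Sigma> \<and> R \<in> cq_rels \<phi> \<and> R' \<in> cq_rels \<psi>}"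


section \<open>Procedures and readiness\<close>

text \<open>\<open>Cols R ss\<close> is the constraint \<open>R[ss]\<close> and \<open>Whole R\<close> is the constraint \<open>R[*]\<close>.\<close>

datatype structure_constraint = Cols relname "attr list" | Whole relname

datatype proc = Proc (scope: "structure_constraint set") (pre: "dependency set")
  (post: "dependency set") (preserved: "query set")

definition wf_proc :: "proc \<Rightarrow> bool" where
  "wf_proc P \<longleftrightarrow> finite (scope P) \<and> finite (pre P) \<and> finite (post P) \<and> finite (preserved P)
     \<and> (\<forall>d\<in>pre P \<union> post P. wf_dependency d) \<and> (\<forall>q\<in>preserved P. wf_query q)"

definition scope_rels :: "proc \<Rightarrow> relname set" where
  "scope_rels P = {R. Whole R \<in> scope P \<or> (\<exists>ss. Cols R ss \<in> scope P)}"

definition scope_attrs :: "proc \<Rightarrow> relname \<Rightarrow> attr set" where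
  "scope_attrs P R = \<Union> {set ss | ss. Cols R ss \<in> scope P}"

definition applicable :: "proc \<Rightarrow> db \<Rightarrow> bool" where
  "applicable P I \<longleftrightarrow> (\<forall>q\<in>preserved P. query_compatible (sch I) q) \<and> models I (pre P)"

definition project :: "attr set \<Rightarrow> tuple set \<Rightarrow> tuple set" where
  "project As X = (\<lambda>t. t |` As) ` X"

definition agree_outside_scope :: "proc \<Rightarrow> db \<Rightarrow> db \<Rightarrow> bool" where
  "agree_outside_scope P I I' \<longleftrightarrow>
     (\<forall>R\<in>dom (sch I). R \<notin> scope_rels P \<longrightarrow> rel I R = rel I' R)
     \<and> (\<forall>T\<in>dom (sch I). T \<in> scope_rels P \<and> Whole T \<notin> scope P \<longrightarrow>
          project (the (sch I T) - scope_attrs P T) (rel I T)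
          = project (the (sch I T) - scope_attrs P T) (rel I' T))"

definition outcomes :: "proc \<Rightarrow> db \<Rightarrow> db set" where
  "outcomes P I = {I'. wf_db I' \<and> sch I' = sch I \<and> applicable P I \<and> models I' (post P)
     \<and> agree_outside_scope P I I' \<and> (\<forall>q\<in>preserved P. query_result q I \<subseteq> query_result q I')}"

definition outcomes_set :: "proc \<Rightarrow> db set \<Rightarrow> db set" where
  "outcomes_set P J = (\<Union>I\<in>J. outcomes P I)"

definition outcomes_seq :: "proc list \<Rightarrow> db \<Rightarrow> db set" where
  "outcomes_seq Ps I = fold outcomes_set Ps {I}"

definition safe_scope :: "proc \<Rightarrow> bool" where
  "safe_scope P \<longleftrightarrow> pre P = {} \<and> acyclic_tgds (post P)
     \<and> scope P = {Whole R | R. \<exists>\<phi> \<psi>. TGD \<phi> \<psi> \<in> post P \<and> R \<in> cq_rels \<psi>}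
     \<and> preserved P = {Total R | R. Whole R \<in> scope P}"

type_synonym readiness_input = "db \<times> proc set \<times> dependency"

fun constraint_ready :: "readiness_input \<Rightarrow> bool" where
  "constraint_ready (I, \<Pi>, \<alpha>) \<longleftrightarrow>
     (\<exists>Ps. Ps \<noteq> [] \<and> set Ps \<subseteq> \<Pi> \<and> (\<forall>J\<in>outcomes_seq Ps I. models J {\<alpha>}))"

definition readiness_inputs :: "readiness_input set" where
  "readiness_inputs =
     {(I, \<Pi>, \<alpha>). wf_db I \<and> finite \<Pi> \<and> (\<forall>P\<in>\<Pi>. wf_proc P) \<and> wf_dependency \<alpha>}"

definition safe_readiness_inputs :: "readiness_input set" where
  "safe_readiness_inputs =
     {(I, \<Pi>, \<alpha>). (I, \<Pi>, \<alpha>) \<in> readiness_inputs \<and> (\<forall>P\<in>\<Pi>. safe_scope P) \<and> acyclic_tgd \<alpha>}"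


section \<open>Decidability\<close>

text \<open>
  Partial recursive functions in the sense of Kleene. \<open>computes p xs y\<close> says that program \<open>p\<close>
  halts on arguments \<open>xs\<close> with result \<open>y\<close>. Recursion and minimisation act on the first argument.
\<close>

datatype recf =
  Zero
| Succ
| Proj nat
| Comp recf "recf list"
| PrimRec recf recf
| Mu recf

inductive computes :: "recf \<Rightarrow> nat list \<Rightarrow> nat \<Rightarrow> bool" where
  Zero: "computes Zero xs 0"
| Succ: "computes Succ [x] (Suc x)"
| Proj: "i < length xs \<Longrightarrow> computes (Proj i) xs (xs ! i)"
| Comp: "length ys = length gs \<Longrightarrow> (\<forall>i<length gs. computes (gs ! i) xs (ys ! i)) \<Longrightarrow>
    computes f ys y \<Longrightarrow> computes (Comp f gs) xs y"
| PrimRec_0: "computes f xs y \<Longrightarrow> computes (PrimRec f g) (0 # xs) y"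
| PrimRec_Suc: "computes (PrimRec f g) (n # xs) r \<Longrightarrow> computes g (n # r # xs) y \<Longrightarrow>
    computes (PrimRec f g) (Suc n # xs) y"
| Mu: "computes f (n # xs) 0 \<Longrightarrow> (\<forall>i<n. \<exists>y. computes f (i # xs) (Suc y)) \<Longrightarrow>
    computes (Mu f) xs n"

lemma computes_deterministic:
  assumes "computes p xs y" and "computes p xs z"
  shows "y = z"
  using assms
proof (induction arbitrary: z rule: computes.induct)
  case (Comp ys gs xs f y)
  from Comp.prems obtain ys' where ys': "length ys' = length gs"
      "\<forall>i<length gs. computes (gs ! i) xs (ys' ! i)" "computes f ys' z"
    by (cases rule: computes.cases) auto
  have "ys = ys'"
    using Comp.hyps(1) Comp.IH(1) ys'(1,2) by (auto intro: nth_equalityI)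
  with Comp.IH(2) ys'(3) show ?case by blast
next
  case (Mu f n xs)
  from Mu.prems have z: "computes f (z # xs) 0 \<and> (\<forall>i<z. \<exists>y. computes f (i # xs) (Suc y))"
    by (cases rule: computes.cases) auto
  show ?case
  proof (rule linorder_cases[of n z])
    assume "n < z"
    with z Mu.IH(1) show ?thesis by fastforce
  next
    assume "z < n"
    with z Mu.IH(2) show ?thesis by fastforce
  qed
next
  case (Zero xs)
  from Zero.prems show ?case by (cases rule: computes.cases) auto
next
  case (Succ x)
  from Succ.prems show ?case by (cases rule: computes.cases) auto
next
  case (Proj i xs)
  from Proj.prems show ?case by (cases rule: computes.cases) auto
next
  case (PrimRec_0 f xs y g)
  from PrimRec_0.prems have "computes f xs z"
    by (cases rule: computes.cases) auto
  with PrimRec_0.IH show ?case by blast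
next
  case (PrimRec_Suc f g n xs r y)
  from PrimRec_Suc.prems obtain r' where
      "computes (PrimRec f g) (n # xs) r'" "computes g (n # r' # xs) z"
    by (cases rule: computes.cases) auto
  with PrimRec_Suc.IH show ?case by blast
qed

text \<open>
  A problem, given by a numeric coding of its inputs, is decidable on a set of inputs if some
  program halts on the code of each of them with the correct answer. Nothing is asked of the
  program on numbers that do not code an input from the set.
\<close>

definition decidable_on :: "('a \<Rightarrow> nat) \<Rightarrow> 'a set \<Rightarrow> ('a \<Rightarrow> bool) \<Rightarrow> bool" where
  "decidable_on code D Q \<longleftrightarrow>
     (\<exists>p. \<forall>x\<in>D. computes p [code x] (if Q x then 1 else 0))"


section \<open>Coding of inputs\<close>

fun code_atom :: "atom \<Rightarrow> nat" where
  "code_atom (Atom R args) = prod_encode (R, list_encode (map prod_encode args))"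

fun code_cq :: "cq \<Rightarrow> nat" where
  "code_cq (CQ zs as) = prod_encode (list_encode zs, list_encode (map code_atom as))"

fun code_query :: "query \<Rightarrow> nat" where
  "code_query (Conj q) = prod_encode (0, code_cq q)"
| "code_query (Total R) = prod_encode (1, R)"

fun code_dependency :: "dependency \<Rightarrow> nat" where
  "code_dependency (TGD \<phi> \<psi>) = prod_encode (0, prod_encode (code_cq \<phi>, code_cq \<psi>))"
| "code_dependency (EGD \<phi> x x') =
     prod_encode (1, prod_encode (code_cq \<phi>, prod_encode (x, x')))"

fun code_structure_constraint :: "structure_constraint \<Rightarrow> nat" where
  "code_structure_constraint (Cols R ss) = prod_encode (0, prod_encode (R, list_encode ss))"
| "code_structure_constraint (Whole R) = prod_encode (1, R)"

text \<open>Finite sets are coded by the bits of \<^const>\<open>set_encode\<close>.\<close>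

fun code_proc :: "proc \<Rightarrow> nat" where
  "code_proc (Proc Sc Cin Cout Qs) =
     prod_encode (set_encode (code_structure_constraint ` Sc),
     prod_encode (set_encode (code_dependency ` Cin),
     prod_encode (set_encode (code_dependency ` Cout),
       set_encode (code_query ` Qs))))"

definition code_db :: "db \<Rightarrow> nat" where
  "code_db I = set_encode
     ((\<lambda>R. prod_encode (R, prod_encode (set_encode (the (sch I R)),
         set_encode ((\<lambda>t. list_encode (unnamed (the (sch I R)) t)) ` rel I R)))) ` dom (sch I))"

fun code_input :: "readiness_input \<Rightarrow> nat" where
  "code_input (I, \<Pi>, \<alpha>) =
     prod_encode (code_db I, prod_encode (set_encode (code_proc ` \<Pi>), code_dependency \<alpha>))"

text \<open>The coding is faithful: distinct inputs have distinct codes.\<close>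

lemma set_encode_image_eq:
  assumes "set_encode (f ` A) = set_encode (f ` B)" "finite A" "finite B" "inj_on f (A \<union> B)"
  shows "A = B"
proof -
  have "f ` A = f ` B"
    using assms(1-3) by (simp add: set_encode_eq)
  then show ?thesis
    using assms(4) by (metis Un_upper1 Un_upper2 inj_on_image_eq_iff)
qed

lemma inj_code_atom: "inj code_atom"
proof (rule injI)
  fix a b assume "code_atom a = code_atom b"
  then show "a = b"
    by (cases a; cases b) (auto simp: list_encode_eq inj_map_eq_map[OF inj_prod_encode])
qed

lemma inj_code_cq: "inj code_cq"
proof (rule injI)
  fix a b assume "code_cq a = code_cq b"
  then show "a = b"
    by (cases a; cases b) (auto simp: list_encode_eq inj_map_eq_map[OF inj_code_atom])
qed

lemma inj_code_query: "inj code_query"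
proof (rule injI)
  fix a b assume "code_query a = code_query b"
  then show "a = b"
    by (cases a; cases b) (auto dest: injD[OF inj_code_cq])
qed

lemma inj_code_dependency: "inj code_dependency"
proof (rule injI)
  fix a b assume "code_dependency a = code_dependency b"
  then show "a = b"
    by (cases a; cases b) (auto dest: injD[OF inj_code_cq])
qed

lemma inj_code_structure_constraint: "inj code_structure_constraint"
proof (rule injI)
  fix a b assume "code_structure_constraint a = code_structure_constraint b"
  then show "a = b"
    by (cases a; cases b) (auto simp: list_encode_eq)
qed

lemma inj_on_code_proc: "inj_on code_proc {P. wf_proc P}"
proof (rule inj_onI)
  fix P P' assume wf: "P \<in> {P. wf_proc P}" "P' \<in> {P. wf_proc P}"
    and eq: "code_proc P = code_proc P'"
  obtain A B C D where P: "P = Proc A B C D" by (cases P)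
  obtain A' B' C' D' where P': "P' = Proc A' B' C' D'" by (cases P')
  have fin: "finite A" "finite B" "finite C" "finite D"
      "finite A'" "finite B'" "finite C'" "finite D'"
    using wf by (simp_all add: P P' wf_proc_def)
  have im: "code_structure_constraint ` A = code_structure_constraint ` A'"
      "code_dependency ` B = code_dependency ` B'" "code_dependency ` C = code_dependency ` C'"
      "code_query ` D = code_query ` D'"
    using eq fin by (simp_all add: P P' set_encode_eq)
  show "P = P'"
    unfolding P P'
    using inj_code_structure_constraint[THEN inj_image_eq_iff, THEN iffD1, OF im(1)]
      inj_code_dependency[THEN inj_image_eq_iff, THEN iffD1, OF im(2)]
      inj_code_dependency[THEN inj_image_eq_iff, THEN iffD1, OF im(3)]
      inj_code_query[THEN inj_image_eq_iff, THEN iffD1, OF im(4)]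
    by simp
qed

lemma inj_on_unnamed:
  assumes "finite As"
  shows "inj_on (unnamed As) {t. dom t = As}"
proof (rule inj_onI)
  fix t u :: tuple
  assume t: "t \<in> {t. dom t = As}" and u: "u \<in> {t. dom t = As}" and eq: "unnamed As t = unnamed As u"
  from eq have eq': "the (t A) = the (u A)" if "A \<in> As" for A
    using that assms by (auto simp: unnamed_def)
  show "t = u"
  proof
    fix A
    show "t A = u A"
    proof (cases "A \<in> As")
      case True
      then obtain v w where "t A = Some v" "u A = Some w" using t u by blast
      with eq'[OF True] show ?thesis by simp
    next
      case False
      then have "A \<notin> dom t" "A \<notin> dom u" using t u by auto
      then show ?thesis by (simp add: domIff)
    qed
  qed
qed

lemma wf_db_facts:
  assumes "wf_db I" "R \<in> dom (sch I)"
  shows "finite (the (sch I R))" "finite (rel I R)" "rel I R \<subseteq> {t. dom t = the (sch I R)}"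
  using assms by (simp_all add: wf_db_def wf_schema_def subset_iff)

lemma inj_on_code_db: "inj_on code_db {I. wf_db I}"
proof (rule inj_onI)
  fix I J assume "I \<in> {I. wf_db I}" "J \<in> {I. wf_db I}" and eq: "code_db I = code_db J"
  then have I: "wf_db I" and J: "wf_db J" by auto
  define c where "c K R = prod_encode (R, prod_encode (set_encode (the (sch K R)),
      set_encode ((\<lambda>t. list_encode (unnamed (the (sch K R)) t)) ` rel K R)))" for K R
  have "finite (dom (sch I))" "finite (dom (sch J))"
    using I J by (auto simp: wf_db_def wf_schema_def)
  with eq have im: "c I ` dom (sch I) = c J ` dom (sch J)"
    by (simp add: code_db_def c_def set_encode_eq)
  have same: "R \<in> dom (sch J) \<and> c I R = c J R" if "R \<in> dom (sch I)" for R
  proof -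
    from that im have "c I R \<in> c J ` dom (sch J)" by blast
    then obtain R' where "R' \<in> dom (sch J)" "c I R = c J R'" by blast
    then show ?thesis by (auto simp: c_def)
  qed
  have same': "R \<in> dom (sch I)" if "R \<in> dom (sch J)" for R
  proof -
    from that im have "c J R \<in> c I ` dom (sch I)" by blast
    then obtain R' where "R' \<in> dom (sch I)" "c J R = c I R'" by blast
    then show ?thesis by (auto simp: c_def)
  qed
  have dom_eq: "dom (sch I) = dom (sch J)"
    using same same' by blast
  have attrs: "the (sch I R) = the (sch J R)" if "R \<in> dom (sch I)" for R
  proof -
    have "set_encode (the (sch I R)) = set_encode (the (sch J R))"
      using same[OF that] by (simp add: c_def)
    moreover have "finite (the (sch I R))" "finite (the (sch J R))"
      using wf_db_facts(1)[OF I that] wf_db_facts(1)[OF J, of R] that dom_eq by simp_all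
    ultimately show ?thesis by (simp add: set_encode_eq)
  qed
  have "sch I R = sch J R" for R
    using dom_eq attrs[of R] by (metis domIff option.expand)
  then have sch_eq: "sch I = sch J" by (rule ext)
  have "rel I R = rel J R" for R
  proof (cases "R \<in> dom (sch I)")
    case True
    define As where "As = the (sch I R)"
    have tuples: "finite As" "finite (rel I R)" "finite (rel J R)"
        "rel I R \<union> rel J R \<subseteq> {t. dom t = As}"
      using wf_db_facts[OF I True] wf_db_facts[OF J, of R] True sch_eq by (simp_all add: As_def)
    have "inj_on (\<lambda>t. list_encode (unnamed As t)) (rel I R \<union> rel J R)"
      using inj_on_subset[OF inj_on_unnamed[OF tuples(1)] tuples(4)]
      by (auto simp: inj_on_def list_encode_eq)
    moreover have "set_encode ((\<lambda>t. list_encode (unnamed As t)) ` rel I R)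
        = set_encode ((\<lambda>t. list_encode (unnamed As t)) ` rel J R)"
      using same[OF True] by (simp add: c_def sch_eq As_def)
    ultimately show ?thesis
      by (intro set_encode_image_eq[OF _ tuples(2,3)])
  next
    case False
    with I J sch_eq show ?thesis by (simp add: wf_db_def)
  qed
  then have "rel I = rel J" by (rule ext)
  with sch_eq show "I = J" by (simp add: db.expand)
qed

lemma inj_on_code_input: "inj_on code_input readiness_inputs"
proof (rule inj_onI)
  fix x y assume x: "x \<in> readiness_inputs" and y: "y \<in> readiness_inputs"
    and eq: "code_input x = code_input y"
  obtain I \<Pi> \<alpha> where x_eq: "x = (I, \<Pi>, \<alpha>)" by (cases x)
  obtain J \<Pi>' \<beta> where y_eq: "y = (J, \<Pi>', \<beta>)" by (cases y)
  have "I = J"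
    using x y eq inj_onD[OF inj_on_code_db, of I J] by (simp add: x_eq y_eq readiness_inputs_def)
  moreover have "\<alpha> = \<beta>"
    using eq injD[OF inj_code_dependency, of \<alpha> \<beta>] by (simp add: x_eq y_eq)
  moreover have "\<Pi> = \<Pi>'"
  proof (rule set_encode_image_eq)
    show "set_encode (code_proc ` \<Pi>) = set_encode (code_proc ` \<Pi>')"
      using eq by (simp add: x_eq y_eq)
    show "finite \<Pi>" "finite \<Pi>'" "inj_on code_proc (\<Pi> \<union> \<Pi>')"
      using x y by (auto simp: x_eq y_eq readiness_inputs_def
          intro!: inj_on_subset[OF inj_on_code_proc])
  qed
  ultimately show "x = y" by (simp add: x_eq y_eq)
qed

end

theory Submission
  imports Defs "HOL-Library.Countable"
begin

text \<open>
  The clauses defining \<^const>\<open>computes\<close> are Horn clauses, so a program \<open>q\<close> can be turned into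
  acyclic tgds, one per procedure; a single existential rule creates successors, hence all numbers.
  Since procedures with safe scope never delete facts, a fact derivable from the tgds is present in
  all outcomes of a suitable sequence. Conversely, the graph of \<open>q\<close> over the natural numbers is an
  infinite model of the tgds, and every sequence has an outcome inside it. So readiness for ``\<open>q\<close> has
  a value on the given input'' is halting of \<open>q\<close>.

  For the diagonalisation no compiler has to be programmed: instead of coding programs by numbers and
  computing the tgds from the code, the code of the tgds of \<open>q\<close> is itself taken as the code of \<open>q\<close>. The
  reduction then only adds the facts that describe the input, which is a simple arithmetic function.
\<close>

section \<open>Instances as sets of facts\<close>

text \<open>
  A pair of a relation symbol and a list of numbers serves both as a fact (the numbers are domain
  values) and as an atom of a rule (the numbers are variables). The \<open>i\<close>-th entry of the list
  belongs to the attribute \<open>i\<close>.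
\<close>

type_synonym 's fact = "'s \<times> nat list"
type_synonym 's rule = "'s fact list \<times> 's fact"

definition subst :: "(nat \<Rightarrow> nat) \<Rightarrow> 's fact \<Rightarrow> 's fact" where
  "subst \<tau> a = (fst a, map \<tau> (snd a))"

definition body_vars :: "'s rule \<Rightarrow> nat set" where
  "body_vars r = (\<Union>a\<in>set (fst r). set (snd a))"

text \<open>Only on the body variables must \<open>\<tau>'\<close> agree with \<open>\<tau>\<close>,
  so the remaining head variables are existential.\<close>

definition obeys :: "'s fact set \<Rightarrow> 's rule \<Rightarrow> bool" where
  "obeys F r \<longleftrightarrow> (\<forall>\<tau>. subst \<tau> ` set (fst r) \<subseteq> F
     \<longrightarrow> (\<exists>\<tau>'. (\<forall>x\<in>body_vars r. \<tau>' x = \<tau> x) \<and> subst \<tau>' (snd r) \<in> F))"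

definition tup :: "nat list \<Rightarrow> tuple" where
  "tup xs = (\<lambda>A. if A < length xs then Some (xs ! A) else None)"

lemma dom_tup: "dom (tup xs) = {..<length xs}"
  by (auto simp: tup_def dom_def split: if_splits)

lemma tup_eq_iff [simp]: "tup xs = tup ys \<longleftrightarrow> xs = ys"
proof
  assume eq: "tup xs = tup ys"
  then have len: "length xs = length ys"
    by (metis dom_tup lessThan_eq_iff)
  show "xs = ys"
  proof (rule nth_equalityI[OF len])
    fix i assume "i < length xs"
    with fun_cong[OF eq, of i] len show "xs ! i = ys ! i"
      by (simp add: tup_def)
  qed
qed simp

lemma inj_tup: "inj tup"
  by (simp add: inj_def)

lemma ex_tup:
  assumes "dom t = {..<n}"
  obtains xs where "t = tup xs" "length xs = n"
proof
  show "t = tup (map (\<lambda>A. the (t A)) [0..<n])"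
  proof
    fix A
    show "t A = tup (map (\<lambda>A. the (t A)) [0..<n]) A"
    proof (cases "A < n")
      case True
      then have "A \<in> dom t" using assms by simp
      with True show ?thesis by (auto simp: tup_def)
    next
      case False
      then have "A \<notin> dom t" using assms by simp
      with False show ?thesis by (auto simp: tup_def)
    qed
  qed
qed simp

lemma unnamed_tup: "length xs = n \<Longrightarrow> unnamed {..<n} (tup xs) = xs"
  by (auto simp: unnamed_def lessThan_atLeast0 tup_def intro: nth_equalityI)

section \<open>Rules as tgds and procedures\<close>

definition mk_atom :: "'s::countable fact \<Rightarrow> atom" where
  "mk_atom a = Atom (to_nat (fst a)) (zip [0..<length (snd a)] (snd a))"

text \<open>All body variables are universal, which is equivalent to an existential quantifier in
  the body for those absent from the head. \<open>remdups\<close> meets the distinctness in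
  \<open>wf_cq\<close>.\<close>

definition dep_of :: "'s::countable rule \<Rightarrow> dependency" where
  "dep_of r = TGD (CQ [] (map mk_atom (fst r)))
     (CQ (filter (\<lambda>x. x \<notin> body_vars r) (remdups (snd (snd r)))) [mk_atom (snd r)])"

text \<open>With a single tgd per procedure, acyclicity concerns each rule separately; recursion
  comes from repeating procedures.\<close>

definition proc_of :: "'s::countable rule \<Rightarrow> proc" where
  "proc_of r = Proc {Whole (to_nat (fst (snd r)))} {} {dep_of r} {Total (to_nat (fst (snd r)))}"

lemma mk_atom_simps [simp]:
  "atom_rel (mk_atom a) = to_nat (fst a)"
  "snd ` set (atom_args (mk_atom a)) = set (snd a)"
  "fst ` set (atom_args (mk_atom a)) = {..<length (snd a)}"
  by (simp_all add: mk_atom_def flip: set_map, auto)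

lemma cq_rels_mk_atom [simp]: "cq_rels (CQ zs (map mk_atom B)) = to_nat ` fst ` set B"
  by (simp add: cq_rels_def image_image)

lemma cq_rels_single [simp]: "cq_rels (CQ zs [a]) = {atom_rel a}"
  by (simp add: cq_rels_def)

locale signature =
  fixes Rs :: "'s::countable set" and ar :: "'s \<Rightarrow> nat"
  assumes finite_Rs: "finite Rs"
begin

definition db_of :: "'s fact set \<Rightarrow> db" where
  "db_of F = DB (\<lambda>R. if R \<in> to_nat ` Rs then Some {..<ar (from_nat R)} else None)
     (\<lambda>R. {tup xs | s xs. R = to_nat s \<and> (s, xs) \<in> F})"

definition valid :: "'s fact set \<Rightarrow> bool" where
  "valid F \<longleftrightarrow> finite F \<and> (\<forall>f\<in>F. fst f \<in> Rs \<and> length (snd f) = ar (fst f))"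

definition wf_rule :: "'s rule \<Rightarrow> bool" where
  "wf_rule r \<longleftrightarrow> fst r \<noteq> [] \<and> fst (snd r) \<notin> fst ` set (fst r)
     \<and> (\<forall>a\<in>insert (snd r) (set (fst r)). fst a \<in> Rs \<and> snd a \<noteq> [] \<and> length (snd a) = ar (fst a))"

lemma sch_db_of [simp]: "sch (db_of F) (to_nat s) = (if s \<in> Rs then Some {..<ar s} else None)"
  by (auto simp: db_of_def)

lemma sch_db_of_eq: "sch (db_of F) = sch (db_of G)"
  by (simp add: db_of_def)

lemma dom_sch_db_of [simp]: "dom (sch (db_of F)) = to_nat ` Rs"
  by (auto simp: db_of_def dom_def split: if_splits)

lemma rel_db_of [simp]: "rel (db_of F) (to_nat s) = tup ` {xs. (s, xs) \<in> F}"
  by (auto simp: db_of_def)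

lemma wf_db_of:
  assumes "valid F"
  shows "wf_db (db_of F)"
proof -
  have "finite {xs. (s, xs) \<in> F}" for s
    using assms finite_vimageI[of F "Pair s"] by (simp add: valid_def vimage_def inj_def)
  moreover have "rel (db_of F) R = {}" if "R \<notin> to_nat ` Rs" for R
    using that assms by (auto simp: db_of_def valid_def)
  moreover have "dom t = {..<ar s}" if "t \<in> rel (db_of F) (to_nat s)" for s t
  proof -
    from that obtain xs where "t = tup xs" "(s, xs) \<in> F" by auto
    with assms show ?thesis by (force simp: dom_tup valid_def)
  qed
  ultimately show ?thesis
    using finite_Rs by (simp add: wf_db_def wf_schema_def)
qed

text \<open>Outcomes are arbitrary well-formed instances, so this is what allows reasoning about
  fact sets alone. The attributes of a relation form an initial segment, hence every tuple is a
  list.\<close>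

lemma ex_db_of:
  assumes wf: "wf_db J" and sch: "sch J = sch (db_of {})"
  obtains F where "valid F" "J = db_of F"
proof
  define F where "F = {(s, xs). s \<in> Rs \<and> tup xs \<in> rel J (to_nat s)}"
  have tuples: "dom t = {..<ar s}" if "t \<in> rel J (to_nat s)" "s \<in> Rs" for t s
  proof -
    have "to_nat s \<in> dom (sch J)" using that(2) by (simp add: sch)
    from wf_db_facts(3)[OF wf this] that show ?thesis by (auto simp: sch)
  qed
  have "F = (\<Union>s\<in>Rs. Pair s ` (tup -` rel J (to_nat s)))"
    by (auto simp: F_def)
  moreover have "finite (tup -` rel J (to_nat s))" if "s \<in> Rs" for s
    using that wf_db_facts(2)[OF wf, of "to_nat s"] sch by (intro finite_vimageI inj_tup) auto
  ultimately have "finite F" using finite_Rs by simp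
  moreover have "length xs = ar s" if "(s, xs) \<in> F" for s xs
    using that tuples[of "tup xs" s] by (auto simp: F_def dom_tup)
  ultimately show "valid F" by (auto simp: valid_def F_def)
  have "rel J R = rel (db_of F) R" for R
  proof (cases "R \<in> to_nat ` Rs")
    case True
    then obtain s where s: "R = to_nat s" "s \<in> Rs" by blast
    have "t \<in> tup ` {xs. tup xs \<in> rel J R}" if "t \<in> rel J R" for t
      using that tuples[of t s] s by (auto elim!: ex_tup)
    then show ?thesis using s by (auto simp: F_def)
  next
    case False
    then have "rel J R = {}" using wf sch by (simp add: wf_db_def)
    moreover have "rel (db_of F) R = {}" using False by (auto simp: db_of_def F_def)
    ultimately show ?thesis by simp
  qed
  then show "J = db_of F"
    using sch sch_db_of_eq[of "{}" F] by (intro db.expand conjI ext) auto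
qed

text \<open>The atom mentions every attribute of its relation, so the valuation fixes the matching
  tuple completely.\<close>

lemma sat_atom_mk_atom:
  assumes "valid F" "length (snd a) = ar (fst a)"
  shows "sat_atom (db_of F) \<tau> (mk_atom a) \<longleftrightarrow> subst \<tau> a \<in> F"
proof -
  have "(\<forall>(A, x)\<in>set (zip [0..<length vs] vs). tup xs A = Some (\<tau> x)) \<longleftrightarrow> xs = map \<tau> vs"
    if "length xs = length vs" for xs vs
  proof -
    have "(\<forall>(A, x)\<in>set (zip [0..<length vs] vs). tup xs A = Some (\<tau> x))
        \<longleftrightarrow> (\<forall>i<length vs. tup xs i = Some (\<tau> (vs ! i)))"
      by (simp add: all_set_conv_all_nth)
    also have "\<dots> \<longleftrightarrow> xs = map \<tau> vs"
      using that by (simp add: tup_def list_eq_iff_nth_eq)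
    finally show ?thesis .
  qed
  moreover have "length xs = length (snd a)" if "(fst a, xs) \<in> F" for xs
    using that assms by (auto simp: valid_def)
  ultimately have "xs = map \<tau> (snd a)
      \<longleftrightarrow> (\<forall>(A, x)\<in>set (zip [0..<length (snd a)] (snd a)). tup xs A = Some (\<tau> x))"
    if "(fst a, xs) \<in> F" for xs
    using that by blast
  then show ?thesis
    by (simp add: sat_atom_def subst_def mk_atom_def Bex_def) blast
qed

lemma holds_dep_of:
  assumes "valid F" "wf_rule r"
  shows "holds (db_of F) (dep_of r) \<longleftrightarrow> obeys F r"
proof -
  have sat: "sat_atom (db_of F) \<tau> (mk_atom a) \<longleftrightarrow> subst \<tau> a \<in> F"
    if "a \<in> insert (snd r) (set (fst r))" for \<tau> a
    using that assms by (intro sat_atom_mk_atom) (auto simp: wf_rule_def)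
  have body: "sat_cq (db_of F) \<tau> (CQ [] (map mk_atom (fst r))) \<longleftrightarrow> subst \<tau> ` set (fst r) \<subseteq> F" for \<tau>
  proof -
    have "(\<forall>x. \<tau>' x = \<tau> x) \<longleftrightarrow> \<tau>' = \<tau>" for \<tau>'
      by (auto simp: fun_eq_iff)
    then show ?thesis by (auto simp: sat_cq_def sat)
  qed
  have "(\<exists>\<tau>'. (\<forall>x. x \<notin> set (filter (\<lambda>x. x \<notin> body_vars r) (remdups (snd (snd r)))) \<longrightarrow> \<tau>' x = \<tau> x)
        \<and> subst \<tau>' (snd r) \<in> F)
      \<longleftrightarrow> (\<exists>\<tau>'. (\<forall>x\<in>body_vars r. \<tau>' x = \<tau> x) \<and> subst \<tau>' (snd r) \<in> F)" for \<tau>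
  proof
    assume "\<exists>\<tau>'. (\<forall>x\<in>body_vars r. \<tau>' x = \<tau> x) \<and> subst \<tau>' (snd r) \<in> F"
    then obtain \<tau>' where \<tau>': "\<forall>x\<in>body_vars r. \<tau>' x = \<tau> x" "subst \<tau>' (snd r) \<in> F" by blast
    \<comment> \<open>\<open>sat_cq\<close> also demands agreement on variables in neither body nor
      head, where \<open>\<tau>'\<close> is free; they are reset to \<open>\<tau>\<close>.\<close>
    define \<tau>'' where "\<tau>'' x = (if x \<in> set (snd (snd r)) then \<tau>' x else \<tau> x)" for x
    have "subst \<tau>'' (snd r) = subst \<tau>' (snd r)" by (simp add: subst_def \<tau>''_def)
    with \<tau>' show "\<exists>\<tau>'. (\<forall>x. x \<notin> set (filter (\<lambda>x. x \<notin> body_vars r) (remdups (snd (snd r)))) \<longrightarrow> \<tau>' x = \<tau> x)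
        \<and> subst \<tau>' (snd r) \<in> F"
      by (intro exI[of _ \<tau>'']) (auto simp: \<tau>''_def)
  qed auto
  then show ?thesis
    by (simp add: dep_of_def body obeys_def) (simp add: sat_cq_def sat)
qed

lemma dependency_compatible_dep_of:
  assumes "wf_rule r"
  shows "dependency_compatible (sch (db_of F)) (dep_of r)"
  using assms by (auto simp: dep_of_def cq_compatible_def atom_compatible_def wf_rule_def)

lemma wf_dependency_dep_of:
  assumes "wf_rule r"
  shows "wf_dependency (dep_of r)"
proof -
  have "wf_atom (mk_atom a)" if "a \<in> insert (snd r) (set (fst r))" for a
    using that assms by (auto simp: wf_atom_def mk_atom_def wf_rule_def)
  then show ?thesis
    using assms by (auto simp: dep_of_def wf_cq_def cq_vars_def free_vars_def wf_rule_def body_vars_def)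
qed

lemma acyclic_tgd_dep_of:
  assumes "wf_rule r"
  shows "acyclic_tgd (dep_of r)"
  using assms by (simp add: dep_of_def wf_rule_def inj_image_mem_iff)

lemma wf_proc_proc_of:
  assumes "wf_rule r"
  shows "wf_proc (proc_of r)"
  using wf_dependency_dep_of[OF assms] by (simp add: proc_of_def wf_proc_def)

text \<open>Every edge of the relation graph ends in the head symbol, which is not in the body and
  so starts no edge.\<close>

lemma safe_scope_proc_of:
  assumes "wf_rule r"
  shows "safe_scope (proc_of r)"
proof -
  let ?h = "to_nat (fst (snd r))" and ?B = "to_nat ` fst ` set (fst r)"
  obtain \<phi> \<psi> where d: "dep_of r = TGD \<phi> \<psi>" "cq_rels \<phi> = ?B" "cq_rels \<psi> = {?h}"
    by (simp add: dep_of_def)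
  have post: "post (proc_of r) = {TGD \<phi> \<psi>}"
    by (simp add: proc_of_def d)
  have edges: "{(R, R'). \<exists>\<phi> \<psi>. TGD \<phi> \<psi> \<in> post (proc_of r) \<and> R \<in> cq_rels \<phi> \<and> R' \<in> cq_rels \<psi>}
      = ?B \<times> {?h}"
    by (simp add: post d set_eq_iff)
  have "?h \<notin> ?B" using assms by (simp add: wf_rule_def inj_image_mem_iff)
  have "R' = ?h \<and> R \<in> ?B" if "(R, R') \<in> (?B \<times> {?h})\<^sup>+" for R R'
    using that by (induction rule: trancl_induct) auto
  with \<open>?h \<notin> ?B\<close> have "acyclic (?B \<times> {?h})"
    unfolding acyclic_def by blast
  then have "acyclic_tgds (post (proc_of r))"
    unfolding acyclic_tgds_def edges by (simp add: post)
  moreover have "{Whole R | R. \<exists>\<phi> \<psi>. TGD \<phi> \<psi> \<in> post (proc_of r) \<and> R \<in> cq_rels \<psi>} = {Whole ?h}"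
    by (simp add: post d)
  ultimately show ?thesis
    by (simp add: safe_scope_def) (simp add: proc_of_def)
qed

text \<open>The bit position that one relation occupies in \<open>code_db\<close>.\<close>

definition entry :: "'s fact set \<Rightarrow> 's \<Rightarrow> nat" where
  "entry F s = prod_encode (to_nat s, prod_encode (set_encode {..<ar s},
     set_encode (list_encode ` {xs. (s, xs) \<in> F})))"

lemma code_db_db_of:
  assumes "valid F"
  shows "code_db (db_of F) = set_encode (entry F ` Rs)"
proof -
  have tuples: "(\<lambda>xs. list_encode (unnamed {..<ar s} (tup xs))) ` {xs. (s, xs) \<in> F}
      = list_encode ` {xs. (s, xs) \<in> F}" for s
  proof (rule image_cong[OF refl])
    fix xs assume "xs \<in> {xs. (s, xs) \<in> F}"
    then have "length xs = ar s" using assms by (auto simp: valid_def)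
    then show "list_encode (unnamed {..<ar s} (tup xs)) = list_encode xs"
      by (simp add: unnamed_tup)
  qed
  then show ?thesis
    unfolding code_db_def dom_sch_db_of image_image entry_def
    by (intro arg_cong[of _ _ set_encode] image_cong refl)
      (simp only: sch_db_of rel_db_of if_True option.sel image_image tuples)
qed

section \<open>Procedures as steps on fact sets\<close>

text \<open>What safe scope leaves of the outcome conditions: the preserved query keeps old facts,
  the scope confines changes to the head relation, and the postcondition holds afterwards.\<close>

definition step :: "'s rule \<Rightarrow> 's fact set \<Rightarrow> 's fact set \<Rightarrow> bool" where
  "step r F F' \<longleftrightarrow> valid F' \<and> F \<subseteq> F' \<and> (\<forall>f\<in>F'. fst f \<noteq> fst (snd r) \<longrightarrow> f \<in> F) \<and> obeys F' r"

primrec steps :: "'s rule list \<Rightarrow> 's fact set \<Rightarrow> 's fact set \<Rightarrow> bool" where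
  "steps [] F F' \<longleftrightarrow> F' = F"
| "steps (r # rs) F F' \<longleftrightarrow> (\<exists>G. step r F G \<and> steps rs G F')"

lemma db_of_outcomes_iff:
  assumes F: "valid F" and F': "valid F'" and r: "wf_rule r"
  shows "db_of F' \<in> outcomes (proc_of r) (db_of F) \<longleftrightarrow> step r F F'"
proof -
  let ?h = "fst (snd r)"
  have h: "?h \<in> Rs" using r by (simp add: wf_rule_def)
  have res: "query_result (Total (to_nat ?h)) (db_of G) = {xs. (?h, xs) \<in> G}" if "valid G" for G
  proof -
    have "length xs = ar ?h" if "(?h, xs) \<in> G" for xs
      using that \<open>valid G\<close> by (auto simp: valid_def)
    then have "unnamed {..<ar ?h} ` tup ` {xs. (?h, xs) \<in> G} = (\<lambda>xs. xs) ` {xs. (?h, xs) \<in> G}"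
      unfolding image_image by (intro image_cong) (simp_all add: unnamed_tup)
    then show ?thesis using h by simp
  qed
  have agree: "agree_outside_scope (proc_of r) (db_of F) (db_of F')
      \<longleftrightarrow> (\<forall>s\<in>Rs. s \<noteq> ?h \<longrightarrow> {xs. (s, xs) \<in> F} = {xs. (s, xs) \<in> F'})"
    by (auto simp: agree_outside_scope_def proc_of_def scope_rels_def inj_image_eq_iff[OF inj_tup])
  have "F \<subseteq> F' \<and> (\<forall>f\<in>F'. fst f \<noteq> ?h \<longrightarrow> f \<in> F)
      \<longleftrightarrow> (\<forall>s\<in>Rs. s \<noteq> ?h \<longrightarrow> {xs. (s, xs) \<in> F} = {xs. (s, xs) \<in> F'})
        \<and> {xs. (?h, xs) \<in> F} \<subseteq> {xs. (?h, xs) \<in> F'}" (is "?L \<longleftrightarrow> ?R")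
  proof
    assume ?L then show ?R by auto
  next
    assume R: ?R
    have "(s, xs) \<in> F \<Longrightarrow> s \<in> Rs" "(s, xs) \<in> F' \<Longrightarrow> s \<in> Rs" for s xs
      using F F' by (auto simp: valid_def)
    moreover have "(s, xs) \<in> F \<Longrightarrow> (s, xs) \<in> F'" for s xs
      using R calculation(1) by (cases "s = ?h") auto
    moreover have "(s, xs) \<in> F' \<Longrightarrow> s \<noteq> ?h \<Longrightarrow> (s, xs) \<in> F" for s xs
      using R calculation(2) by blast
    ultimately show ?L by auto
  qed
  moreover have "db_of F' \<in> outcomes (proc_of r) (db_of F) \<longleftrightarrow> obeys F' r
      \<and> agree_outside_scope (proc_of r) (db_of F) (db_of F')
      \<and> query_result (Total (to_nat ?h)) (db_of F) \<subseteq> query_result (Total (to_nat ?h)) (db_of F')"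
    using h wf_db_of[OF F'] dependency_compatible_dep_of[OF r, of F'] holds_dep_of[OF F' r]
      sch_db_of_eq[of F F']
    by (simp add: outcomes_def applicable_def models_def proc_of_def del: query_result.simps)
  ultimately show ?thesis
    unfolding step_def agree res[OF F] res[OF F'] using F' by blast
qed

lemma outcomes_proc_of:
  assumes "valid F" "wf_rule r"
  shows "outcomes (proc_of r) (db_of F) = db_of ` {F'. step r F F'}"
proof (intro equalityI subsetI)
  fix J assume J: "J \<in> outcomes (proc_of r) (db_of F)"
  then have "wf_db J" "sch J = sch (db_of {})"
    using sch_db_of_eq[of F "{}"] by (auto simp: outcomes_def)
  then obtain F' where "valid F'" "J = db_of F'" by (rule ex_db_of)
  with J db_of_outcomes_iff[OF assms(1) _ assms(2)] show "J \<in> db_of ` {F'. step r F F'}" by blast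
next
  fix J assume "J \<in> db_of ` {F'. step r F F'}"
  then obtain F' where "step r F F'" "J = db_of F'" by blast
  with db_of_outcomes_iff[OF assms(1) _ assms(2)] show "J \<in> outcomes (proc_of r) (db_of F)"
    by (auto simp: step_def)
qed

lemma steps_append: "steps (rs @ rs') F F' \<longleftrightarrow> (\<exists>G. steps rs F G \<and> steps rs' G F')"
  by (induction rs arbitrary: F) auto

lemma steps_mono: "steps rs F F' \<Longrightarrow> F \<subseteq> F'"
proof (induction rs arbitrary: F)
  case (Cons r rs)
  then obtain G where "step r F G" "steps rs G F'" by auto
  with Cons.IH[of G] show ?case by (auto simp: step_def)
qed simp

text \<open>Used for \<open>Input\<close>, the head of no rule, so that no outcome contains a second
  input.\<close>

lemma steps_unchanged:
  assumes "steps rs F F'" "f \<in> F'" "\<forall>r\<in>set rs. fst f \<noteq> fst (snd r)"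
  shows "f \<in> F"
  using assms
proof (induction rs arbitrary: F)
  case (Cons r rs)
  then obtain G where "step r F G" "steps rs G F'" by auto
  with Cons show ?case by (auto simp: step_def)
qed simp

lemma steps_valid: "steps rs F F' \<Longrightarrow> valid F \<Longrightarrow> valid F'"
  by (induction rs arbitrary: F) (auto simp: step_def)

lemma outcomes_seq_proc_of:
  assumes "valid F" "\<forall>r\<in>set rs. wf_rule r"
  shows "outcomes_seq (map proc_of rs) (db_of F) = db_of ` {F'. steps rs F F'}"
  using assms(2)
proof (induction rs rule: rev_induct)
  case (snoc r rs)
  have "outcomes_seq (map proc_of (rs @ [r])) (db_of F)
      = (\<Union>G\<in>{G. steps rs F G}. outcomes (proc_of r) (db_of G))"
    using snoc by (simp add: outcomes_seq_def outcomes_set_def)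
  also have "\<dots> = (\<Union>G\<in>{G. steps rs F G}. db_of ` {F'. step r G F'})"
    using snoc.prems assms(1) by (simp add: outcomes_proc_of steps_valid)
  also have "\<dots> = db_of ` {F'. steps (rs @ [r]) F F'}"
    by (auto simp: steps_append)
  finally show ?case .
next
  case Nil
  have "{F'. steps [] F F'} = {F}" by auto
  then show ?case by (simp add: outcomes_seq_def)
qed

text \<open>
  A step only has to add one witness for each of the finitely many matches of the rule body, and
  the witnesses can be taken from any model of the rules, however large. The new facts match no
  body atom because the head relation is not in the body.
\<close>

lemma ex_step_in_model:
  assumes F: "valid F" and r: "wf_rule r" and M: "F \<subseteq> M" "obeys M r"
  obtains F' where "step r F F'" "F' \<subseteq> M"
proof -
  define V where "V = body_vars r"
  define D where "D = (\<Union>f\<in>F. set (snd f))"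
  \<comment> \<open>One representative per match: only body values matter, and they come from the
    finite set \<open>D\<close>; the default 0 elsewhere makes \<open>T\<close> finite.\<close>
  define T where "T = {\<tau>. (\<forall>x. (x \<in> V \<longrightarrow> \<tau> x \<in> D) \<and> (x \<notin> V \<longrightarrow> \<tau> x = 0))
      \<and> subst \<tau> ` set (fst r) \<subseteq> F}"
  have "finite V" "finite D"
    using F by (simp_all add: V_def D_def body_vars_def valid_def)
  then have "finite {\<tau>. \<forall>x. (x \<in> V \<longrightarrow> \<tau> x \<in> D) \<and> (x \<notin> V \<longrightarrow> \<tau> x = (0::nat))}"
    by (rule finite_set_of_finite_funs)
  then have "finite T" by (rule rev_finite_subset) (auto simp: T_def)
  have "\<forall>\<tau>\<in>T. \<exists>\<tau>'. (\<forall>x\<in>V. \<tau>' x = \<tau> x) \<and> subst \<tau>' (snd r) \<in> M"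
    using M by (auto simp: T_def V_def obeys_def)
  then obtain e where e: "\<And>\<tau>. \<tau> \<in> T \<Longrightarrow> (\<forall>x\<in>V. e \<tau> x = \<tau> x) \<and> subst (e \<tau>) (snd r) \<in> M"
    by metis
  define F' where "F' = F \<union> (\<lambda>\<tau>. subst (e \<tau>) (snd r)) ` T"
  have "F' \<subseteq> M" using M(1) e by (auto simp: F'_def)
  have "valid F'"
    using F r \<open>finite T\<close> by (auto simp: F'_def valid_def wf_rule_def subst_def)
  moreover have outside: "\<forall>f\<in>F'. fst f \<noteq> fst (snd r) \<longrightarrow> f \<in> F"
    by (auto simp: F'_def subst_def)
  moreover have "obeys F' r"
    unfolding obeys_def
  proof (intro allI impI)
    fix \<tau> assume "subst \<tau> ` set (fst r) \<subseteq> F'"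
    moreover have "fst (subst \<tau> a) \<noteq> fst (snd r)" if "a \<in> set (fst r)" for a
      using that r by (simp add: wf_rule_def subst_def) (metis image_eqI)
    ultimately have body: "subst \<tau> ` set (fst r) \<subseteq> F"
      using outside by blast
    \<comment> \<open>The representative in \<open>T\<close> of the match
      \<open>\<tau>\<close>.\<close>
    define \<tau>0 where "\<tau>0 x = (if x \<in> V then \<tau> x else 0)" for x
    have "subst \<tau>0 a = subst \<tau> a" if "a \<in> set (fst r)" for a
      using that by (auto simp: subst_def \<tau>0_def V_def body_vars_def)
    then have "subst \<tau>0 ` set (fst r) \<subseteq> F" using body by auto
    moreover have "\<tau> x \<in> D" if "x \<in> V" for x
    proof -
      from that obtain a where "a \<in> set (fst r)" "x \<in> set (snd a)"
        by (auto simp: V_def body_vars_def)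
      with body show ?thesis by (force simp: D_def subst_def)
    qed
    ultimately have "\<tau>0 \<in> T" by (auto simp: T_def \<tau>0_def)
    with e show "\<exists>\<tau>'. (\<forall>x\<in>body_vars r. \<tau>' x = \<tau> x) \<and> subst \<tau>' (snd r) \<in> F'"
      by (intro exI[of _ "e \<tau>0"]) (auto simp: F'_def \<tau>0_def V_def)
  qed
  ultimately have "step r F F'" by (auto simp: step_def F'_def)
  then show thesis using \<open>F' \<subseteq> M\<close> by (rule that)
qed

lemma ex_steps_in_model:
  assumes "valid F" "F \<subseteq> M" "\<forall>r\<in>set rs. wf_rule r \<and> obeys M r"
  shows "\<exists>F'. steps rs F F' \<and> F' \<subseteq> M"
  using assms
proof (induction rs arbitrary: F)
  case (Cons r rs)
  then obtain G where G: "step r F G" "G \<subseteq> M"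
    by (auto elim: ex_step_in_model)
  with Cons.IH[of G] Cons.prems show ?case by (auto simp: step_def)
qed simp

end


section \<open>Rules for partial recursive functions\<close>

instance recf :: countable by countable_datatype

text \<open>
  \<open>Val f k\<close> holds for \<open>y # xs\<close> if \<open>f\<close> maps the \<open>k\<close> arguments \<open>xs\<close> to \<open>y\<close>, and \<open>Pre f k\<close> for \<open>n # xs\<close>
  if \<open>f\<close> is positive on \<open>i # xs\<close> for all \<open>i < n\<close>. \<open>ValC\<close> and \<open>PreC\<close> are copies of \<open>Val\<close> and \<open>Pre\<close>: a
  recursive rule reads the copy, so that its head relation does not occur in its body. In the rules, the
  variables from 4 on hold \<open>xs\<close> and, for \<open>Comp\<close>, the intermediate values; 0 to 3 are scratch.
\<close>

datatype sym = Nought | Next | Num | Input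
  | Val recf nat | ValC recf nat | Pre recf nat | PreC recf nat

instance sym :: countable by countable_datatype

fun arity :: "sym \<Rightarrow> nat" where
  "arity Nought = 1"
| "arity Next = 2"
| "arity Num = 1"
| "arity Input = 2"
| "arity (Val f k) = Suc k"
| "arity (ValC f k) = Suc k"
| "arity (Pre f k) = Suc k"
| "arity (PreC f k) = Suc k"

definition args :: "nat \<Rightarrow> nat list" where
  "args k = [4..<4 + k]"

text \<open>Guards that bring argument variables into the body, as otherwise they would be
  existential in the head.\<close>

definition nums :: "nat list \<Rightarrow> sym fact list" where
  "nums vs = map (\<lambda>v. (Num, [v])) vs"

text \<open>The third rule generates all numbers; its head variable 1 is existential.\<close>

definition base_rules :: "sym rule list" where
  "base_rules =
    [([(Nought, [0])], (Num, [0])),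
     ([(Next, [0, 1])], (Num, [1])),
     ([(Num, [0])], (Next, [0, 1]))]"

text \<open>The rules follow the clauses of \<open>computes\<close>, with copying rules added. The
  bounded quantifier in the \<open>Mu\<close> clause is unrolled through \<open>Pre\<close>, where
  \<open>(Next, [3, 2])\<close> says that the value is positive.\<close>

fun rules :: "recf \<Rightarrow> nat \<Rightarrow> sym rule list" where
  "rules Zero k = [((Nought, [0]) # nums (args k), (Val Zero k, 0 # args k))]"
| "rules Succ k = (if k = 1 then [([(Next, [4, 0])], (Val Succ 1, [0, 4]))] else [])"
| "rules (Proj i) k = (if i < k then [(nums (args k), (Val (Proj i) k, (4 + i) # args k))] else [])"
| "rules (Comp f gs) k =
    [((Val f (length gs), 0 # [4 + k..<4 + k + length gs]) # nums (args k)
        @ map (\<lambda>j. (Val (gs ! j) k, (4 + k + j) # args k)) [0..<length gs],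
      (Val (Comp f gs) k, 0 # args k))]"
| "rules (PrimRec f g) 0 = []"
| "rules (PrimRec f g) (Suc k) =
    [([(Nought, [1]), (Val f k, 0 # args k)], (Val (PrimRec f g) (Suc k), 0 # 1 # args k)),
     ([(Val (PrimRec f g) (Suc k), 0 # 1 # args k)], (ValC (PrimRec f g) (Suc k), 0 # 1 # args k)),
     ([(Next, [1, 2]), (ValC (PrimRec f g) (Suc k), 3 # 1 # args k),
        (Val g (Suc (Suc k)), 0 # 1 # 3 # args k)],
      (Val (PrimRec f g) (Suc k), 0 # 2 # args k))]"
| "rules (Mu f) k =
    [((Nought, [0]) # nums (args k), (Pre f k, 0 # args k)),
     ([(Pre f k, 0 # args k)], (PreC f k, 0 # args k)),
     ([(PreC f k, 0 # args k), (Next, [0, 1]), (Val f (Suc k), 2 # 0 # args k), (Next, [3, 2])],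
      (Pre f k, 1 # args k)),
     ([(Pre f k, 0 # args k), (Val f (Suc k), 1 # 0 # args k), (Nought, [1])],
      (Val (Mu f) k, 0 # args k))]"

text \<open>The arity of a program determines those of its subprograms, so finitely many symbols
  \<open>Val g j\<close> suffice.\<close>

fun all_rules :: "recf \<Rightarrow> nat \<Rightarrow> sym rule set" where
  "all_rules (Comp f gs) k =
    set (rules (Comp f gs) k) \<union> all_rules f (length gs) \<union> (\<Union>g\<in>set gs. all_rules g k)"
| "all_rules (PrimRec f g) k =
    set (rules (PrimRec f g) k) \<union> all_rules f (k - 1) \<union> all_rules g (Suc k)"
| "all_rules (Mu f) k = set (rules (Mu f) k) \<union> all_rules f (Suc k)"
| "all_rules f k = set (rules f k)"

lemma finite_all_rules: "finite (all_rules f k)"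
  by (induction f k rule: all_rules.induct) auto

lemma all_rules_cases: "r \<in> all_rules f k \<Longrightarrow> \<exists>g j. r \<in> set (rules g j)"
  by (induction f k rule: all_rules.induct) (simp_all del: rules.simps, blast+)

lemma length_args [simp]: "length (args k) = k"
  by (simp add: args_def)

lemma set_args [simp]: "set (args k) = {4..<4 + k}"
  by (simp add: args_def)

lemma args_eq_Nil [simp]: "args k = [] \<longleftrightarrow> k = 0"
  by (simp add: args_def)

text \<open>The part of \<open>wf_rule\<close> that is independent of the chosen set of symbols,
  together with the protection of \<open>Input\<close>.\<close>

definition well_shaped :: "sym rule \<Rightarrow> bool" where
  "well_shaped r \<longleftrightarrow> fst r \<noteq> [] \<and> fst (snd r) \<notin> insert Input (fst ` set (fst r))
     \<and> (\<forall>a\<in>insert (snd r) (set (fst r)). snd a \<noteq> [] \<and> length (snd a) = arity (fst a))"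

lemma well_shaped_base_rules: "r \<in> set base_rules \<Longrightarrow> well_shaped r"
  by (auto simp: base_rules_def well_shaped_def)

text \<open>Keeps the head symbol of a rule apart from the symbols of subprograms in its body, as
  acyclicity requires.\<close>

lemma subterm_neq:
  "Comp f gs \<noteq> f" "PrimRec f g \<noteq> f" "PrimRec f g \<noteq> g" "Mu f \<noteq> f"
  by (auto dest: arg_cong[of _ _ size])

lemma Comp_notin: "Comp f gs \<notin> set gs"
proof
  assume "Comp f gs \<in> set gs"
  then have "size (Comp f gs) \<le> size_list size gs"
    by (rule size_list_estimation') simp
  then show False by simp
qed

lemma well_shaped_rules: "r \<in> set (rules f k) \<Longrightarrow> well_shaped r"
proof (induction f k rule: rules.induct)
  case (4 f gs k)
  then show ?case
    by (auto simp: well_shaped_def nums_def subterm_neq) (metis Comp_notin nth_mem)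
qed (auto simp: well_shaped_def nums_def subterm_neq split: if_splits)

section \<open>The model over the natural numbers\<close>

text \<open>The model is infinite and hence no instance itself; it serves as an upper bound for a
  suitable outcome.\<close>

fun in_model :: "nat \<Rightarrow> nat \<Rightarrow> sym \<Rightarrow> nat list \<Rightarrow> bool" where
  "in_model c e Nought xs \<longleftrightarrow> xs = [0]"
| "in_model c e Next xs \<longleftrightarrow> (\<exists>i. xs = [i, Suc i])"
| "in_model c e Num xs \<longleftrightarrow> (\<exists>i. xs = [i])"
| "in_model c e Input xs \<longleftrightarrow> xs = [c, e]"
| "in_model c e (Val f k) xs \<longleftrightarrow> (\<exists>y ys. xs = y # ys \<and> length ys = k \<and> computes f ys y)"
| "in_model c e (ValC f k) xs \<longleftrightarrow> (\<exists>y ys. xs = y # ys \<and> length ys = k \<and> computes f ys y)"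
| "in_model c e (Pre f k) xs \<longleftrightarrow> (\<exists>n ys. xs = n # ys \<and> length ys = k
     \<and> (\<forall>i<n. \<exists>y. computes f (i # ys) (Suc y)))"
| "in_model c e (PreC f k) xs \<longleftrightarrow> (\<exists>n ys. xs = n # ys \<and> length ys = k
     \<and> (\<forall>i<n. \<exists>y. computes f (i # ys) (Suc y)))"

definition model :: "nat \<Rightarrow> nat \<Rightarrow> sym fact set" where
  "model c e = {(s, xs). in_model c e s xs}"

lemma obeys_model_base_rules:
  assumes "r \<in> set base_rules"
  shows "obeys (model c e) r"
proof -
  have "\<exists>\<tau>'. \<tau>' 0 = \<tau> 0 \<and> \<tau>' (Suc 0) = Suc (\<tau>' 0)" for \<tau> :: "nat \<Rightarrow> nat"
    by (rule exI[of _ "\<tau>(1 := Suc (\<tau> 0))"]) simp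
  then show ?thesis
    using assms by (auto simp: base_rules_def obeys_def subst_def model_def body_vars_def)
qed

lemma obeysD:
  assumes "obeys F r" "subst \<tau> ` set (fst r) \<subseteq> F"
  obtains \<tau>' where "\<And>x. x \<in> body_vars r \<Longrightarrow> \<tau>' x = \<tau> x" "subst \<tau>' (snd r) \<in> F"
  using assms unfolding obeys_def by blast

lemma obeys_singleD:
  assumes "obeys F ([a], b)" "subst \<tau> a \<in> F"
  shows "\<exists>\<tau>'. (\<forall>x\<in>set (snd a). \<tau>' x = \<tau> x) \<and> subst \<tau>' b \<in> F"
  using assms unfolding obeys_def body_vars_def by simp

lemma obeysI:
  assumes "\<And>\<tau>. subst \<tau> ` set (fst r) \<subseteq> F \<Longrightarrow> subst \<tau> (snd r) \<in> F"
  shows "obeys F r"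
  using assms unfolding obeys_def by blast

lemma obeys_model_rules:
  assumes "r \<in> set (rules f k)"
  shows "obeys (model c e) r"
proof (rule obeysI)
  fix \<tau> assume body: "subst \<tau> ` set (fst r) \<subseteq> model c e"
  then show "subst \<tau> (snd r) \<in> model c e"
    using assms
  proof (induction f k rule: rules.induct)
    case (1 k)
    then show ?case by (auto simp: subst_def model_def intro: computes.Zero)
  next
    case (2 k)
    then show ?case by (auto simp: subst_def model_def intro: computes.Succ split: if_splits)
  next
    case (3 i k)
    then show ?case
      using computes.Proj[of i "map \<tau> (args k)"]
      by (auto simp: subst_def model_def args_def split: if_splits)
  next
    case (4 f gs k)
    then show ?case
      using computes.Comp[of "map \<tau> [4 + k..<4 + k + length gs]" gs "map \<tau> (args k)" f "\<tau> 0"]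
      by (auto simp: subst_def model_def nums_def image_subset_iff ball_Un)
  next
    case (6 f g k)
    then show ?case
      by (auto simp: subst_def model_def intro: computes.PrimRec_0 computes.PrimRec_Suc)
  next
    case (7 f k)
    then show ?case
      using computes.Mu[of f "\<tau> 0" "map \<tau> (args k)"]
      by (auto simp: subst_def model_def less_Suc_eq) blast
  qed simp
qed


text \<open>The valuation for the variable layout of \<open>rules\<close>: four scratch values, the
  arguments, the intermediate values of \<open>Comp\<close>.\<close>

definition env :: "nat \<Rightarrow> nat \<Rightarrow> nat \<Rightarrow> nat \<Rightarrow> nat list \<Rightarrow> nat list \<Rightarrow> nat \<Rightarrow> nat" where
  "env a b c d xs ys = (!) (a # b # c # d # xs @ ys)"

lemma env_simps [simp]:
  "env a b c d xs ys 0 = a"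
  "env a b c d xs ys (Suc 0) = b"
  "env a b c d xs ys 2 = c"
  "env a b c d xs ys 3 = d"
  "i < length xs \<Longrightarrow> env a b c d xs ys (4 + i) = xs ! i"
  "j < length ys \<Longrightarrow> env a b c d xs ys (4 + length xs + j) = ys ! j"
  by (simp_all add: env_def nth_append numeral_2_eq_2 numeral_3_eq_3 eval_nat_numeral)

lemma map_env [simp]:
  "map (env a b c d xs ys) (args (length xs)) = xs"
  "map (env a b c d xs ys) [4 + length xs..<4 + length xs + length ys] = ys"
  by (rule nth_equalityI; simp add: args_def)+

text \<open>The code of the start instance below, whose constant part has code \<open>n\<close>.\<close>

definition db_code :: "nat \<Rightarrow> nat \<Rightarrow> nat \<Rightarrow> nat" where
  "db_code n c e = 2 ^ prod_encode (to_nat Next,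
       prod_encode (set_encode {..<2}, \<Sum>i<c + e. 2 ^ list_encode [i, Suc i]))
     + (2 ^ prod_encode (to_nat Input, prod_encode (set_encode {..<2}, 2 ^ list_encode [c, e])) + n)"

section \<open>The readiness input of a program\<close>

locale reduction =
  fixes q :: recf
begin

text \<open>Arity 2, because \<open>q\<close> will receive the two numbers that describe its own
  readiness input.\<close>

definition prog_rules :: "sym rule set" where
  "prog_rules = set base_rules \<union> all_rules q 2"

text \<open>\<open>Input\<close> occurs in no rule, and \<open>Val q 2\<close> in none if
  \<open>q\<close> has no rules at arity 2; the start facts and the goal still need them.\<close>

definition symbols :: "sym set" where
  "symbols = {Nought, Next, Num, Input, Val q 2}
     \<union> (\<Union>r\<in>prog_rules. insert (fst (snd r)) (fst ` set (fst r)))"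

lemma symbols_simps [simp]:
  "Nought \<in> symbols" "Next \<in> symbols" "Num \<in> symbols" "Input \<in> symbols" "Val q 2 \<in> symbols"
  by (simp_all add: symbols_def)

lemma finite_prog_rules: "finite prog_rules"
  by (simp add: prog_rules_def finite_all_rules)

sublocale signature symbols arity
  by standard (simp add: symbols_def finite_prog_rules)

lemma prog_rules_cases: "r \<in> prog_rules \<Longrightarrow> r \<in> set base_rules \<or> (\<exists>g j. r \<in> set (rules g j))"
  using all_rules_cases[of r q 2] by (auto simp: prog_rules_def)

lemma well_shaped_prog_rules: "r \<in> prog_rules \<Longrightarrow> well_shaped r"
  using prog_rules_cases well_shaped_base_rules well_shaped_rules by blast

lemma wf_rule_prog_rules:
  assumes "r \<in> prog_rules"
  shows "wf_rule r"
proof -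
  have "fst a \<in> symbols" if "a \<in> insert (snd r) (set (fst r))" for a
    using that assms unfolding symbols_def by blast
  with well_shaped_prog_rules[OF assms] show ?thesis
    by (simp add: wf_rule_def well_shaped_def)
qed

lemma obeys_model_prog_rules: "r \<in> prog_rules \<Longrightarrow> obeys (model c e) r"
  using prog_rules_cases obeys_model_base_rules obeys_model_rules by blast

definition goal :: "sym rule" where
  "goal = ([(Input, [0, 1])], (Val q 2, [2, 0, 1]))"

lemma wf_rule_goal: "wf_rule goal"
  by (simp add: goal_def wf_rule_def)

text \<open>The true successors up to \<open>c + e\<close> are supplied, since the existential rule
  may pick arbitrary values and need not lead to \<open>c\<close> and \<open>e\<close>.\<close>

definition start :: "nat \<Rightarrow> nat \<Rightarrow> sym fact set" where
  "start c e = {(Nought, [0]), (Input, [c, e])} \<union> (\<lambda>i. (Next, [i, Suc i])) ` {..<c + e}"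

lemma valid_start: "valid (start c e)"
  by (auto simp: valid_def start_def)

lemma start_subset_model: "start c e \<subseteq> model c e"
  by (auto simp: start_def model_def)

section \<open>Facts present in all outcomes\<close>

text \<open>
  The values \<open>h 0, h 1, \<dots>, h K\<close> play the role of the numbers up to \<open>K\<close> in an instance where the
  existential rule may have chosen arbitrary successors.
\<close>

definition chain :: "nat \<Rightarrow> (nat \<Rightarrow> nat) \<Rightarrow> sym fact set \<Rightarrow> bool" where
  "chain K h F \<longleftrightarrow> (Nought, [h 0]) \<in> F \<and> (\<forall>i<K. (Next, [h i, h (Suc i)]) \<in> F)"

lemma chain_mono: "chain K h F \<Longrightarrow> F \<subseteq> G \<Longrightarrow> L \<le> K \<Longrightarrow> chain L h G"
  by (auto simp: chain_def)

text \<open>The sequence \<open>rs\<close> is chosen before the outcome and thus before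
  \<open>h\<close>. The facts of \<open>A\<close> use true numbers and are read through
  \<open>h\<close>; \<open>K\<close> is the chain length the derivation consumes.\<close>

definition forced :: "sym fact set \<Rightarrow> bool" where
  "forced A \<longleftrightarrow> (\<exists>rs K. set rs \<subseteq> prog_rules
     \<and> (\<forall>F F' h. chain K h F \<longrightarrow> steps rs F F' \<longrightarrow> subst h ` A \<subseteq> F'))"

text \<open>The two sequences are concatenated; steps only add facts, so neither the first set nor
  the chain is lost.\<close>

lemma forced_Un:
  assumes "forced A" "forced B"
  shows "forced (A \<union> B)"
proof -
  obtain rs K where A: "set rs \<subseteq> prog_rules"
      "\<And>F F' h. chain K h F \<Longrightarrow> steps rs F F' \<Longrightarrow> subst h ` A \<subseteq> F'"
    using assms(1) unfolding forced_def by blast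
  obtain rs' K' where B: "set rs' \<subseteq> prog_rules"
      "\<And>F F' h. chain K' h F \<Longrightarrow> steps rs' F F' \<Longrightarrow> subst h ` B \<subseteq> F'"
    using assms(2) unfolding forced_def by blast
  have "subst h ` (A \<union> B) \<subseteq> F'" if ch: "chain (max K K') h F" and st: "steps (rs @ rs') F F'" for F F' h
  proof -
    obtain G where G: "steps rs F G" "steps rs' G F'"
      using st by (auto simp: steps_append)
    have "subst h ` A \<subseteq> G"
      by (rule A(2)[OF _ G(1)]) (rule chain_mono[OF ch], simp_all)
    moreover have "subst h ` B \<subseteq> F'"
      by (rule B(2)[OF _ G(2)]) (rule chain_mono[OF ch steps_mono[OF G(1)]], simp)
    ultimately show ?thesis using steps_mono[OF G(2)] by blast
  qed
  with A(1) B(1) show ?thesis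
    unfolding forced_def by (intro exI[of _ "rs @ rs'"] exI[of _ "max K K'"]) auto
qed

lemma forced_finite:
  assumes "finite A" "\<And>a. a \<in> A \<Longrightarrow> forced {a}"
  shows "forced A"
  using assms
proof (induction A rule: finite_induct)
  case empty
  show ?case unfolding forced_def by (intro exI[of _ "[]"]) simp
next
  case (insert a A)
  then show ?case using forced_Un[of "{a}" A] by simp
qed

lemma subst_subst: "subst h (subst \<tau> a) = subst (h \<circ> \<tau>) a"
  by (simp add: subst_def)

text \<open>Appends \<open>r\<close> to a sequence forcing its body. Without existential head
  variables, the fact demanded by \<open>r\<close> is uniquely determined.\<close>

lemma forced_rule:
  assumes r: "r \<in> prog_rules" and vars: "set (snd (snd r)) \<subseteq> body_vars r"
    and body: "\<And>a. a \<in> set (fst r) \<Longrightarrow> forced {subst \<tau> a}"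
    and f: "subst \<tau> (snd r) = f"
  shows "forced {f}"
proof -
  have "forced (subst \<tau> ` set (fst r))"
  proof (rule forced_finite)
    fix b assume "b \<in> subst \<tau> ` set (fst r)"
    then obtain a where "b = subst \<tau> a" "a \<in> set (fst r)" by blast
    then show "forced {b}" using body by simp
  qed simp
  then obtain rs K where rs: "set rs \<subseteq> prog_rules"
      "\<And>F F' h. chain K h F \<Longrightarrow> steps rs F F' \<Longrightarrow> subst h ` subst \<tau> ` set (fst r) \<subseteq> F'"
    unfolding forced_def by blast
  have "subst h f \<in> F'" if ch: "chain K h F" and st: "steps (rs @ [r]) F F'" for F F' h
  proof -
    obtain G where G: "steps rs F G" "step r G F'"
      using st by (auto simp: steps_append)
    have obeys: "obeys F' r" and "G \<subseteq> F'"
      using G(2) by (simp_all add: step_def)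
    \<comment> \<open>The outcome knows numbers only through \<open>h\<close>, so the rule is
      matched under \<open>h \<circ> \<tau>\<close>.\<close>
    have "subst (h \<circ> \<tau>) ` set (fst r) = subst h ` subst \<tau> ` set (fst r)"
      by (simp add: image_image subst_subst)
    also have "\<dots> \<subseteq> F'"
      using rs(2)[OF ch G(1)] \<open>G \<subseteq> F'\<close> by (rule subset_trans)
    finally obtain \<tau>' where \<tau>': "\<And>x. x \<in> body_vars r \<Longrightarrow> \<tau>' x = (h \<circ> \<tau>) x"
        "subst \<tau>' (snd r) \<in> F'"
      by (rule obeysD[OF obeys]) blast
    have "subst \<tau>' (snd r) = subst (h \<circ> \<tau>) (snd r)"
      unfolding subst_def using vars \<tau>'(1) by (simp add: subset_iff)
    also have "\<dots> = subst h f"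
      by (simp only: subst_subst[symmetric] f)
    finally show ?thesis using \<tau>'(2) by simp
  qed
  then have "\<forall>F F' h. chain K h F \<longrightarrow> steps (rs @ [r]) F F' \<longrightarrow> subst h ` {f} \<subseteq> F'"
    by simp
  moreover have "set (rs @ [r]) \<subseteq> prog_rules" using rs(1) r by simp
  ultimately show ?thesis
    unfolding forced_def by blast
qed

lemma forced_Nought: "forced {(Nought, [0])}"
  unfolding forced_def by (intro exI[of _ "[]"] exI[of _ 0]) (simp add: chain_def subst_def)

lemma forced_Next: "forced {(Next, [i, Suc i])}"
  unfolding forced_def by (intro exI[of _ "[]"] exI[of _ "Suc i"]) (simp add: chain_def subst_def)

lemma base_rules_prog_rules: "r \<in> set base_rules \<Longrightarrow> r \<in> prog_rules"
  by (simp add: prog_rules_def)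

lemma forced_Num: "forced {(Num, [i])}"
proof (cases i)
  case 0
  show ?thesis
    by (rule forced_rule[where r = "([(Nought, [0])], (Num, [0]))" and \<tau> = "\<lambda>_. 0"])
      (auto intro: base_rules_prog_rules simp: base_rules_def body_vars_def subst_def forced_Nought 0)
next
  case (Suc j)
  show ?thesis
    by (rule forced_rule[where r = "([(Next, [0, 1])], (Num, [1]))" and \<tau> = "\<lambda>v. j + v"])
      (auto intro: base_rules_prog_rules simp: base_rules_def body_vars_def subst_def forced_Next Suc)
qed

text \<open>The derivation of \<open>computes\<close> is replayed clause by clause with the
  corresponding rules, \<open>env\<close> supplying the values of their variables.\<close>

lemma computes_forced:
  assumes "computes f xs y" "all_rules f (length xs) \<subseteq> prog_rules"
  shows "forced {(Val f (length xs), y # xs)}"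
  using assms
proof (induction rule: computes.induct)
  case (Zero xs)
  show ?case
    by (rule forced_rule[where r = "hd (rules recf.Zero (length xs))" and \<tau> = "env 0 0 0 0 xs []"])
      (use Zero in \<open>auto simp: body_vars_def subst_def nums_def forced_Nought forced_Num\<close>)
next
  case (Succ x)
  show ?case
    by (rule forced_rule[where r = "hd (rules recf.Succ 1)" and \<tau> = "env (Suc x) 0 0 0 [x] []"])
      (use Succ env_simps(5)[of 0 "[x]" "Suc x" 0 0 0 "[]"]
        in \<open>auto simp: body_vars_def subst_def forced_Next\<close>)
next
  case (Proj i xs)
  show ?case
    by (rule forced_rule[where r = "hd (rules (recf.Proj i) (length xs))" and \<tau> = "env 0 0 0 0 xs []"])
      (use Proj in \<open>auto simp: body_vars_def subst_def nums_def forced_Num\<close>)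
next
  case (Comp ys gs xs f y)
  have len: "length gs = length ys" using Comp.hyps(1) by simp
  have "all_rules (gs ! j) (length xs) \<subseteq> prog_rules" if "j < length ys" for j
  proof -
    have "gs ! j \<in> set gs" using that len by simp
    then have "all_rules (gs ! j) (length xs) \<subseteq> all_rules (recf.Comp f gs) (length xs)" by auto
    with Comp.prems show ?thesis by (rule subset_trans[rotated])
  qed
  then have vals: "forced {(Val (gs ! j) (length xs), ys ! j # xs)}" if "j < length ys" for j
    using Comp.IH(1) that len by auto
  have val: "forced {(Val f (length ys), y # ys)}"
    using Comp.prems Comp.IH(2) len by auto
  show ?case
    by (rule forced_rule[where r = "hd (rules (recf.Comp f gs) (length xs))" and \<tau> = "env y 0 0 0 xs ys"])
      (use Comp.prems val vals len in \<open>auto simp: body_vars_def subst_def nums_def forced_Num\<close>)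
next
  case (PrimRec_0 f xs y g)
  then have val: "forced {(Val f (length xs), y # xs)}" by auto
  show ?case
    by (rule forced_rule[where r = "rules (PrimRec f g) (Suc (length xs)) ! 0" and \<tau> = "env y 0 0 0 xs []"])
      (use PrimRec_0.prems val in \<open>auto simp: body_vars_def subst_def forced_Nought\<close>)
next
  case (PrimRec_Suc f g n xs z y)
  then have rec: "forced {(Val (PrimRec f g) (Suc (length xs)), z # n # xs)}"
    and val: "forced {(Val g (Suc (Suc (length xs))), y # n # z # xs)}"
    by auto
  have copy: "forced {(ValC (PrimRec f g) (Suc (length xs)), z # n # xs)}"
    by (rule forced_rule[where r = "rules (PrimRec f g) (Suc (length xs)) ! 1" and \<tau> = "env z n 0 0 xs []"])
      (use PrimRec_Suc.prems rec in \<open>auto simp: body_vars_def subst_def\<close>)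
  show ?case
    by (rule forced_rule[where r = "rules (PrimRec f g) (Suc (length xs)) ! 2" and \<tau> = "env y n (Suc n) z xs []"])
      (use PrimRec_Suc.prems val copy in \<open>auto simp: body_vars_def subst_def forced_Next\<close>)
next
  case (Mu f n xs)
  then have val: "forced {(Val f (Suc (length xs)), 0 # n # xs)}" by auto
  have pos: "\<exists>y. forced {(Val f (Suc (length xs)), Suc y # i # xs)}" if "i < n" for i
    using Mu that by force
  \<comment> \<open>The bounded quantifier is built up one argument at a time, each round going
    through the copy \<open>PreC\<close>.\<close>
  have "forced {(Pre f (length xs), i # xs)}" if "i \<le> n" for i
    using that
  proof (induction i)
    case 0
    show ?case
      by (rule forced_rule[where r = "rules (recf.Mu f) (length xs) ! 0" and \<tau> = "env 0 0 0 0 xs []"])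
        (use Mu.prems in \<open>auto simp: body_vars_def subst_def nums_def forced_Nought forced_Num\<close>)
  next
    case (Suc i)
    then have pre: "forced {(Pre f (length xs), i # xs)}" by simp
    have copy: "forced {(PreC f (length xs), i # xs)}"
      by (rule forced_rule[where r = "rules (recf.Mu f) (length xs) ! 1" and \<tau> = "env i 0 0 0 xs []"])
        (use Mu.prems pre in \<open>auto simp: body_vars_def subst_def\<close>)
    obtain y where val: "forced {(Val f (Suc (length xs)), Suc y # i # xs)}"
      using pos[of i] Suc.prems by auto
    \<comment> \<open>Variables 2 and 3 are \<open>Suc y\<close> and \<open>y\<close>, so that
      \<open>Next\<close> certifies a positive value.\<close>
    show ?case
      by (rule forced_rule[where r = "rules (recf.Mu f) (length xs) ! 2"
            and \<tau> = "env i (Suc i) (Suc y) y xs []"])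
        (use Mu.prems copy val in \<open>auto simp: body_vars_def subst_def forced_Next\<close>)
  qed
  then have pre: "forced {(Pre f (length xs), n # xs)}" by simp
  show ?case
    by (rule forced_rule[where r = "rules (recf.Mu f) (length xs) ! 3" and \<tau> = "env n 0 0 0 xs []"])
      (use Mu.prems pre val in \<open>auto simp: body_vars_def subst_def forced_Nought\<close>)
qed

text \<open>Each pass through \<open>base_rules\<close> forces a successor of the last chain
  element. The sequence is fixed, whereas \<open>h\<close> depends on the outcome and stays the
  identity up to \<open>m\<close>.\<close>

lemma ex_chain:
  assumes "m \<le> K" "chain m id F"
  shows "\<exists>rs. set rs \<subseteq> prog_rules \<and> (\<forall>F'. steps rs F F' \<longrightarrow> (\<exists>h. chain K h F' \<and> (\<forall>i\<le>m. h i = i)))"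
  using assms
proof (induction K rule: dec_induct)
  case base
  then show ?case by (intro exI[of _ "[]"]) auto
next
  case (step K)
  then obtain rs where rs: "set rs \<subseteq> prog_rules"
      "\<And>F'. steps rs F F' \<Longrightarrow> \<exists>h. chain K h F' \<and> (\<forall>i\<le>m. h i = i)"
    by blast
  have "\<exists>h. chain (Suc K) h F' \<and> (\<forall>i\<le>m. h i = i)" if st: "steps (rs @ base_rules) F F'" for F'
  proof -
    obtain G G1 G2 where G: "steps rs F G" "step (base_rules ! 0) G G1"
        "step (base_rules ! 1) G1 G2" "step (base_rules ! 2) G2 F'"
      using st by (auto simp: steps_append base_rules_def)
    obtain h where h: "chain K h G" "\<forall>i\<le>m. h i = i" using rs(2)[OF G(1)] by blast
    have incl: "G \<subseteq> G1" "G1 \<subseteq> G2" "G2 \<subseteq> F'"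
      and obeys: "obeys G1 (base_rules ! 0)" "obeys G2 (base_rules ! 1)" "obeys F' (base_rules ! 2)"
      using G by (auto simp: step_def)
    \<comment> \<open>The existential rule fires only on \<open>Num\<close>; the end of the chain
      gets there by the first rule if \<open>K\<close> is 0, else by the second.\<close>
    have num: "(Num, [h K]) \<in> F'"
    proof (cases K)
      case 0
      have "(Nought, [h 0]) \<in> G1" using h incl by (auto simp: chain_def)
      with obeys(1) obeys_singleD[of G1 "(Nought, [0])" "(Num, [0])" "\<lambda>_. h 0"]
      have "(Num, [h 0]) \<in> G1" by (auto simp: base_rules_def subst_def)
      then show ?thesis using incl 0 by auto
    next
      case (Suc j)
      have "(Next, [h j, h K]) \<in> G2" using h incl Suc by (auto simp: chain_def)
      with obeys(2) obeys_singleD[of G2 "(Next, [0, 1])" "(Num, [1])"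
          "\<lambda>v. if v = 0 then h j else h K"]
      have "(Num, [h K]) \<in> G2" by (auto simp: base_rules_def subst_def)
      then show ?thesis using incl by auto
    qed
    with obeys(3) obeys_singleD[of F' "(Num, [0])" "(Next, [0, 1])" "\<lambda>_. h K"]
    obtain y where y: "(Next, [h K, y]) \<in> F'" by (auto simp: base_rules_def subst_def)
    \<comment> \<open>The value \<open>y\<close> chosen by the outcome may be an old one, as
      \<open>h\<close> need not be injective.\<close>
    let ?h = "h(Suc K := y)"
    have "chain K h F'" using h(1) incl by (auto intro: chain_mono)
    then have "chain (Suc K) ?h F'" using y by (auto simp: chain_def less_Suc_eq)
    then show ?thesis using h(2) step.hyps by (intro exI[of _ ?h]) auto
  qed
  then show ?case
    using rs(1) base_rules_prog_rules by (intro exI[of _ "rs @ base_rules"]) auto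
qed

lemma steps_Input:
  assumes "set rs \<subseteq> prog_rules" "steps rs (start c e) F"
  shows "(Input, [a, b]) \<in> F \<longleftrightarrow> a = c \<and> b = e"
proof
  assume "(Input, [a, b]) \<in> F"
  moreover have "\<forall>r\<in>set rs. fst (Input, [a, b]) \<noteq> fst (snd r)"
  proof
    fix r assume "r \<in> set rs"
    with assms(1) have "well_shaped r" using well_shaped_prog_rules by blast
    then show "fst (Input, [a, b]) \<noteq> fst (snd r)" by (auto simp: well_shaped_def)
  qed
  ultimately have "(Input, [a, b]) \<in> start c e" by (rule steps_unchanged[OF assms(2)])
  then show "a = c \<and> b = e" by (auto simp: start_def)
next
  assume "a = c \<and> b = e"
  then show "(Input, [a, b]) \<in> F"
    using steps_mono[OF assms(2)] by (auto simp: start_def)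
qed

lemma computes_goal_forced:
  assumes "computes q [c, e] y"
  shows "\<exists>rs. rs \<noteq> [] \<and> set rs \<subseteq> prog_rules \<and> (\<forall>F. steps rs (start c e) F \<longrightarrow> obeys F goal)"
proof -
  have "forced {(Val q 2, [y, c, e])}"
    using computes_forced[OF assms] by (simp add: prog_rules_def numeral_2_eq_2)
  then obtain rs K where rs: "set rs \<subseteq> prog_rules"
      "\<And>F F' h. chain K h F \<Longrightarrow> steps rs F F' \<Longrightarrow> (Val q 2, [h y, h c, h e]) \<in> F'"
    unfolding forced_def by (auto simp: subst_def)
  have "chain (c + e) id (start c e)"
    by (auto simp: chain_def start_def)
  then obtain rs0 where rs0: "set rs0 \<subseteq> prog_rules"
      "\<And>F. steps rs0 (start c e) F \<Longrightarrow> \<exists>h. chain (max K (c + e)) h F \<and> (\<forall>i\<le>c + e. h i = i)"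
    using ex_chain[of "c + e" "max K (c + e)" "start c e"] by auto
  \<comment> \<open>First the chain is made long enough, then the value is derived; the final
    \<open>base_rules\<close> ensure a non-empty sequence.\<close>
  let ?rs = "rs0 @ rs @ base_rules"
  have sub: "set ?rs \<subseteq> prog_rules" using rs rs0 base_rules_prog_rules by auto
  have "obeys F goal" if st: "steps ?rs (start c e) F" for F
  proof -
    obtain G G' where G: "steps rs0 (start c e) G" "steps rs G G'" "steps base_rules G' F"
      using st by (auto simp: steps_append)
    obtain h where h: "chain (max K (c + e)) h G" "\<forall>i\<le>c + e. h i = i"
      using rs0(2)[OF G(1)] by blast
    have "chain K h G" using h(1) by (rule chain_mono) auto
    then have "(Val q 2, [h y, h c, h e]) \<in> F"
      using rs(2) G(2) steps_mono[OF G(3)] by blast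
    \<comment> \<open>The inputs are fixed by \<open>h\<close>, but the value may appear as some
      other \<open>h y\<close>; the existential variable of \<open>goal\<close> accepts it.\<close>
    with h(2) have val: "(Val q 2, [h y, c, e]) \<in> F" by simp
    show ?thesis
      unfolding obeys_def
    proof (intro allI impI)
      fix \<tau> assume "subst \<tau> ` set (fst goal) \<subseteq> F"
      then have "\<tau> 0 = c" "\<tau> 1 = e"
        using steps_Input[OF sub st] by (auto simp: goal_def subst_def)
      with val show "\<exists>\<tau>'. (\<forall>x\<in>body_vars goal. \<tau>' x = \<tau> x) \<and> subst \<tau>' (snd goal) \<in> F"
        by (intro exI[of _ "\<tau>(2 := h y)"]) (simp add: goal_def body_vars_def subst_def)
    qed
  qed
  with sub show ?thesis by (intro exI[of _ ?rs]) (simp add: base_rules_def)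
qed

text \<open>Readiness applies to every outcome, in particular to one inside the model, where a
  \<open>Val\<close> fact is a true computation.\<close>

lemma goal_computes:
  assumes rs: "set rs \<subseteq> prog_rules" and goal: "\<And>F. steps rs (start c e) F \<Longrightarrow> obeys F goal"
  shows "\<exists>y. computes q [c, e] y"
proof -
  obtain F where F: "steps rs (start c e) F" "F \<subseteq> model c e"
    using ex_steps_in_model[OF valid_start start_subset_model, of rs c e] rs
      wf_rule_prog_rules obeys_model_prog_rules by blast
  have "(Input, [c, e]) \<in> F" using steps_Input[OF rs F(1)] by simp
  with goal[OF F(1)] obeys_singleD[of F "(Input, [0, 1])" "(Val q 2, [2, 0, 1])"
      "\<lambda>v. if v = 0 then c else e"]
  obtain y where "(Val q 2, [y, c, e]) \<in> F" by (auto simp: goal_def subst_def)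
  with F(2) have "(Val q 2, [y, c, e]) \<in> model c e" by blast
  then show ?thesis by (auto simp: model_def)
qed

definition input :: "nat \<Rightarrow> nat \<Rightarrow> readiness_input" where
  "input c e = (db_of (start c e), proc_of ` prog_rules, dep_of goal)"

lemma input_safe: "input c e \<in> safe_readiness_inputs"
  using wf_db_of[OF valid_start] finite_prog_rules wf_proc_proc_of[OF wf_rule_prog_rules]
    safe_scope_proc_of[OF wf_rule_prog_rules] wf_dependency_dep_of[OF wf_rule_goal]
    acyclic_tgd_dep_of[OF wf_rule_goal]
  by (auto simp: input_def safe_readiness_inputs_def readiness_inputs_def)

lemma ready_iff: "constraint_ready (input c e) \<longleftrightarrow> (\<exists>y. computes q [c, e] y)"
proof -
  have outcome: "(\<forall>J\<in>outcomes_seq (map proc_of rs) (db_of (start c e)). models J {dep_of goal})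
      \<longleftrightarrow> (\<forall>F. steps rs (start c e) F \<longrightarrow> obeys F goal)" if rs: "set rs \<subseteq> prog_rules" for rs
  proof -
    have "models (db_of F) {dep_of goal} \<longleftrightarrow> obeys F goal" if "steps rs (start c e) F" for F
      using holds_dep_of[OF steps_valid[OF that valid_start] wf_rule_goal]
        dependency_compatible_dep_of[OF wf_rule_goal]
      by (simp add: models_def)
    then show ?thesis
      using rs wf_rule_prog_rules by (subst outcomes_seq_proc_of[OF valid_start]) auto
  qed
  have "constraint_ready (input c e) \<longleftrightarrow> (\<exists>rs. rs \<noteq> [] \<and> set rs \<subseteq> prog_rules
      \<and> (\<forall>J\<in>outcomes_seq (map proc_of rs) (db_of (start c e)). models J {dep_of goal}))" (is "_ \<longleftrightarrow> ?R")
  proof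
    assume "constraint_ready (input c e)"
    then obtain Ps where Ps: "Ps \<noteq> []" "set Ps \<subseteq> proc_of ` prog_rules"
        "\<forall>J\<in>outcomes_seq Ps (db_of (start c e)). models J {dep_of goal}"
      by (auto simp: input_def)
    then have "Ps \<in> map proc_of ` lists prog_rules"
      unfolding lists_image[symmetric] by (auto simp: in_lists_conv_set)
    then obtain rs where "Ps = map proc_of rs" "set rs \<subseteq> prog_rules"
      by (auto simp: in_lists_conv_set)
    with Ps show ?R by auto
  next
    assume ?R
    then obtain rs where rs: "rs \<noteq> []" "set rs \<subseteq> prog_rules"
        "\<forall>J\<in>outcomes_seq (map proc_of rs) (db_of (start c e)). models J {dep_of goal}"
      by blast
    then show "constraint_ready (input c e)"
      unfolding input_def constraint_ready.simps
      by (intro exI[of _ "map proc_of rs"]) (simp add: image_mono)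
  qed
  also have "\<dots> \<longleftrightarrow> (\<exists>rs. rs \<noteq> [] \<and> set rs \<subseteq> prog_rules \<and> (\<forall>F. steps rs (start c e) F \<longrightarrow> obeys F goal))"
    using outcome by blast
  also have "\<dots> \<longleftrightarrow> (\<exists>y. computes q [c, e] y)"
    using computes_goal_forced goal_computes by blast
  finally show ?thesis .
qed


section \<open>The arithmetic code of the readiness input\<close>

text \<open>Only the relations \<open>Next\<close> and \<open>Input\<close> vary with
  \<open>c\<close> and \<open>e\<close>; \<open>Nought\<close> holds one fact and the others are
  empty.\<close>

definition constant_part :: nat where
  "constant_part = set_encode (entry {(Nought, [0])} ` (symbols - {Next, Input}))"

text \<open>Like \<open>constant_part\<close>, this depends on \<open>q\<close> alone and can
  therefore be passed to \<open>q\<close> as an argument.\<close>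

definition program_code :: nat where
  "program_code = prod_encode (set_encode (code_proc ` proc_of ` prog_rules), code_dependency (dep_of goal))"

text \<open>Entries of different symbols differ since each contains its symbol, so
  \<open>set_encode\<close> splits into a sum of powers of two.\<close>

lemma code_db_start: "code_db (db_of (start c e)) = db_code constant_part c e"
proof -
  let ?E = "entry (start c e)"
  define S where "S = symbols - {Next, Input}"
  have inj: "?E s = ?E s' \<longleftrightarrow> s = s'" for s s'
    by (auto simp: entry_def)
  have sym: "symbols = insert Next (insert Input S)"
    by (auto simp: S_def)
  have const: "?E ` S = entry {(Nought, [0])} ` S"
  proof (rule image_cong[OF refl])
    fix s assume "s \<in> S"
    then have "{xs. (s, xs) \<in> start c e} = {xs. (s, xs) \<in> {(Nought, [0])}}"
      by (auto simp: start_def S_def)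
    then show "?E s = entry {(Nought, [0])} s" by (simp add: entry_def)
  qed
  have "finite S" using finite_Rs by (simp add: S_def)
  moreover have "?E Input \<notin> ?E ` S" "?E Next \<notin> insert (?E Input) (?E ` S)"
    by (auto simp: inj S_def)
  moreover have "code_db (db_of (start c e)) = set_encode (insert (?E Next) (insert (?E Input) (?E ` S)))"
    unfolding code_db_db_of[OF valid_start] by (subst sym) simp
  ultimately have "code_db (db_of (start c e)) = 2 ^ ?E Next + (2 ^ ?E Input + constant_part)"
    by (simp add: constant_part_def set_encode_insert const flip: S_def)
  moreover have "{xs. (Input, xs) \<in> start c e} = {[c, e]}"
    by (auto simp: start_def)
  moreover have "{xs. (Next, xs) \<in> start c e} = (\<lambda>i. [i, Suc i]) ` {..<c + e}"
    by (auto simp: start_def)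
  then have "list_encode ` {xs. (Next, xs) \<in> start c e} = (\<lambda>i. list_encode [i, Suc i]) ` {..<c + e}"
    by (simp add: image_image del: list_encode.simps)
  moreover have "set_encode ((\<lambda>i. list_encode [i, Suc i]) ` {..<c + e}) = (\<Sum>i<c + e. 2 ^ list_encode [i, Suc i])"
    unfolding set_encode_def
    by (subst sum.reindex) (auto simp: inj_on_def list_encode_eq simp del: list_encode.simps)
  ultimately show ?thesis
    by (simp add: db_code_def entry_def set_encode_insert del: list_encode.simps)
qed

lemma code_input_input: "code_input (input c e) = prod_encode (db_code constant_part c e, program_code)"
  by (simp add: input_def program_code_def code_db_start)

end

section \<open>Diagonalisation\<close>

definition computable :: "nat \<Rightarrow> (nat list \<Rightarrow> nat) \<Rightarrow> bool" where
  "computable n f \<longleftrightarrow> (\<exists>p. \<forall>xs. length xs = n \<longrightarrow> computes p xs (f xs))"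

lemma computable_nth: "i < n \<Longrightarrow> computable n (\<lambda>xs. xs ! i)"
  unfolding computable_def by (auto intro!: exI[of _ "Proj i"] computes.Proj)

lemma computable_comp:
  assumes "computable (length gs) f" "\<forall>g\<in>set gs. computable n g"
  shows "computable n (\<lambda>xs. f (map (\<lambda>g. g xs) gs))"
proof -
  obtain p where p: "\<And>ys. length ys = length gs \<Longrightarrow> computes p ys (f ys)"
    using assms(1) by (auto simp: computable_def)
  obtain r where r: "\<And>g xs. g \<in> set gs \<Longrightarrow> length xs = n \<Longrightarrow> computes (r g) xs (g xs)"
    using assms(2) unfolding computable_def by metis
  have "computes (Comp p (map r gs)) xs (f (map (\<lambda>g. g xs) gs))" if "length xs = n" for xs
    using that by (intro computes.Comp[where ys = "map (\<lambda>g. g xs) gs"] p) (auto intro: r)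
  then show ?thesis unfolding computable_def by blast
qed

lemma computable_comp1: "computable 1 (\<lambda>ys. f (ys ! 0)) \<Longrightarrow> computable n g \<Longrightarrow> computable n (\<lambda>xs. f (g xs))"
  using computable_comp[of "[g]" "\<lambda>ys. f (ys ! 0)" n] by simp

lemma computable_comp2:
  "computable 2 (\<lambda>ys. f (ys ! 0) (ys ! 1)) \<Longrightarrow> computable n g \<Longrightarrow> computable n h
    \<Longrightarrow> computable n (\<lambda>xs. f (g xs) (h xs))"
  using computable_comp[of "[g, h]" "\<lambda>ys. f (ys ! 0) (ys ! 1)" n] by (simp add: numeral_2_eq_2)

lemma computable_Suc: "computable n f \<Longrightarrow> computable n (\<lambda>xs. Suc (f xs))"
proof (rule computable_comp1[where f = Suc])
  show "computable 1 (\<lambda>ys. Suc (ys ! 0))"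
    unfolding computable_def by (auto simp: length_Suc_conv intro!: exI[of _ Succ] computes.Succ)
qed

lemma computable_const: "computable n (\<lambda>xs. k)"
proof (induction k)
  case 0
  show ?case unfolding computable_def by (auto intro: computes.Zero)
next
  case (Suc k)
  then show ?case by (rule computable_Suc)
qed

text \<open>Recursion equations for a given \<open>h\<close> allow sums and powers to be treated
  without writing programs.\<close>

lemma computable_rec:
  assumes "computable n f" "computable (Suc (Suc n)) g"
    and "\<And>xs. length xs = n \<Longrightarrow> h (0 # xs) = f xs"
    and "\<And>k xs. length xs = n \<Longrightarrow> h (Suc k # xs) = g (k # h (k # xs) # xs)"
  shows "computable (Suc n) h"
proof -
  obtain p where p: "\<And>xs. length xs = n \<Longrightarrow> computes p xs (f xs)"
    using assms(1) by (auto simp: computable_def)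
  obtain r where r: "\<And>xs. length xs = Suc (Suc n) \<Longrightarrow> computes r xs (g xs)"
    using assms(2) by (auto simp: computable_def)
  have "computes (PrimRec p r) (k # xs) (h (k # xs))" if "length xs = n" for k xs
  proof (induction k)
    case 0
    show ?case using that p[of xs] by (simp add: assms(3) computes.PrimRec_0)
  next
    case (Suc k)
    have "computes r (k # h (k # xs) # xs) (g (k # h (k # xs) # xs))"
      using that by (intro r) simp
    with Suc show ?case using that by (simp add: assms(4) computes.PrimRec_Suc)
  qed
  then show ?thesis
    unfolding computable_def by (intro exI[of _ "PrimRec p r"]) (auto simp: length_Suc_conv)
qed

lemma computable_add:
  assumes "computable n f" "computable n g"
  shows "computable n (\<lambda>xs. f xs + g xs)"
proof (rule computable_comp2[OF _ assms])
  have "computable (Suc 1) (\<lambda>ys. ys ! 0 + ys ! 1)"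
  proof (rule computable_rec)
    show "computable 1 (\<lambda>xs. xs ! 0)" by (rule computable_nth) simp
    show "computable (Suc (Suc 1)) (\<lambda>xs. Suc (xs ! 1))"
      by (rule computable_Suc[OF computable_nth]) simp
  qed simp_all
  then show "computable 2 (\<lambda>ys. ys ! 0 + ys ! 1)" by (simp add: numeral_2_eq_2)
qed

lemma computable_sum:
  assumes "computable 1 (\<lambda>ys. t (ys ! 0))" "computable n f"
  shows "computable n (\<lambda>xs. \<Sum>i<f xs. t i)"
proof (rule computable_comp1[OF _ assms(2)])
  have "computable (Suc 0) (\<lambda>ys. \<Sum>i<ys ! 0. t i)"
  proof (rule computable_rec)
    show "computable 0 (\<lambda>xs. 0)" by (rule computable_const)
    show "computable (Suc (Suc 0)) (\<lambda>xs. xs ! 1 + t (xs ! 0))"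
      by (intro computable_add computable_comp1[OF assms(1)] computable_nth) simp_all
  qed simp_all
  then show "computable 1 (\<lambda>ys. \<Sum>i<ys ! 0. t i)" by simp
qed

lemma computable_power2:
  assumes "computable n f"
  shows "computable n (\<lambda>xs. 2 ^ f xs)"
proof (rule computable_comp1[OF _ assms])
  have "computable (Suc 0) (\<lambda>ys. 2 ^ (ys ! 0))"
  proof (rule computable_rec)
    show "computable 0 (\<lambda>xs. 1)" by (rule computable_const)
    show "computable (Suc (Suc 0)) (\<lambda>xs. xs ! 1 + xs ! 1)"
      by (intro computable_add computable_nth) simp_all
  qed simp_all
  then show "computable 1 (\<lambda>ys. 2 ^ (ys ! 0))" by simp
qed

text \<open>Replaces the product and division in the pairing function by a sum.\<close>

lemma triangle_eq_sum: "triangle n = (\<Sum>i<n. Suc i)"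
  by (induction n) simp_all

lemma computable_prod_encode:
  assumes "computable n f" "computable n g"
  shows "computable n (\<lambda>xs. prod_encode (f xs, g xs))"
  unfolding prod_encode_def triangle_eq_sum prod.case
  by (intro computable_add computable_sum computable_Suc computable_nth assms) simp

lemma computable_db_code:
  assumes "computable n f" "computable n g" "computable n h"
  shows "computable n (\<lambda>xs. db_code (f xs) (g xs) (h xs))"
  unfolding db_code_def list_encode.simps
  by (intro computable_add computable_sum computable_power2 computable_prod_encode computable_Suc
      computable_const computable_nth assms) simp_all

text \<open>
  The program \<open>q\<close> receives the two halves of the code of its own readiness input and halts iff the
  supposed decision procedure \<open>p\<close> answers that the input is not ready.
\<close>

lemma not_decidable_safe: "\<not> decidable_on code_input safe_readiness_inputs constraint_ready"
proof
  assume "decidable_on code_input safe_readiness_inputs constraint_ready"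
  then obtain p where p: "\<And>x. x \<in> safe_readiness_inputs
      \<Longrightarrow> computes p [code_input x] (if constraint_ready x then 1 else 0)"
    by (auto simp: decidable_on_def)
  \<comment> \<open>The first argument is the search variable of \<open>Mu\<close> and is ignored.
    The second is used twice, as constant part of the code and as first component of the
    \<open>Input\<close> fact.\<close>
  have "computable 3 (\<lambda>xs. prod_encode (db_code (xs ! 1) (xs ! 1) (xs ! 2), xs ! 2))"
    by (intro computable_prod_encode computable_db_code computable_nth) simp_all
  then obtain r where r: "\<And>xs. length xs = 3
      \<Longrightarrow> computes r xs (prod_encode (db_code (xs ! 1) (xs ! 1) (xs ! 2), xs ! 2))"
    by (auto simp: computable_def)
  \<comment> \<open>The body does not depend on the search variable, so minimisation stops at once
    on answer 0 and never on answer 1.\<close>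
  define q where "q = Mu (Comp p [r])"
  interpret reduction q .
  \<comment> \<open>Self-application: these two numbers belong to \<open>q\<close> itself, so
    \<open>r\<close> computes the code of \<open>input c e\<close> from them.\<close>
  define c where "c = constant_part"
  define e where "e = program_code"
  have run: "computes (Comp p [r]) [n, c, e] (if constraint_ready (input c e) then 1 else 0)" for n
    using r[of "[n, c, e]"] p[OF input_safe, of c e]
    by (intro computes.Comp[where ys = "[code_input (input c e)]"])
      (simp_all add: code_input_input c_def e_def)
  have "(\<exists>y. computes q [c, e] y) \<longleftrightarrow> \<not> constraint_ready (input c e)"
  proof
    assume "\<exists>y. computes q [c, e] y"
    then obtain n where "computes (Comp p [r]) [n, c, e] 0"
      by (auto simp: q_def elim: computes.cases)
    then show "\<not> constraint_ready (input c e)"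
      using computes_deterministic[OF _ run] by fastforce
  next
    assume "\<not> constraint_ready (input c e)"
    then show "\<exists>y. computes q [c, e] y"
      using run[of 0] computes.Mu[of "Comp p [r]" 0 "[c, e]"] by (auto simp: q_def)
  qed
  then show False using ready_iff[of c e] by blast
qed

theorem proposition10:
  shows "\<not> decidable_on code_input readiness_inputs constraint_ready
    \<and> \<not> decidable_on code_input safe_readiness_inputs constraint_ready"
proof -
  have "safe_readiness_inputs \<subseteq> readiness_inputs"
    by (auto simp: safe_readiness_inputs_def)
  then have "decidable_on code_input readiness_inputs constraint_ready
      \<Longrightarrow> decidable_on code_input safe_readiness_inputs constraint_ready"
    unfolding decidable_on_def by blast
  with not_decidable_safe show ?thesis by blast
qed

end
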